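(* Assume $f_0\le_{LR}f_1$. In the single-sensor model with general transmit-queue discipline described in the context, let $C_m^{(F)}$, $C_m^{(A)}$ and $C_m^{(L)}$ denote the CUSUM statistics computed at the decision maker at the end of slot $m$ when the queue discipline is first-come-first-served (FCFS), an alternate non-FCFS (non-idling) discipline, and last-come-first-served (LCFS), respectively. Then $$C_m^{(F)}\ \le_{st}\ C_m^{(A)}\ \le_{st}\ C_m^{(L)},\qquad m\ge1.$$
   Context: Orders: for densities $f,g$, $f\le_{LR}g$ means $g(x)f(y)\le f(x)g(y)$ for all $x\le y$ in the union of the supports of $f$ and $g$. For random variables, $X\le_{st}Y$ means $P(X>x)\le P(Y>x)$ for all $x\in\mathbb R$. Model: time is divided into unit slots; slot $k$ is $[k-1,k)$. A sensor produces a new measurement in each slot with probability $r$, $0<r<1$, independently across slots, and the corresponding packet joins an infinite-buffer transmit queue. $Q_k$ is the number of packets in the queue at the beginning of slot $k$; $Q_1$ is known to the decision maker (DM). If $Q_k>0$ one queued packet is transmitted to the DM in slot $k$; unsuccessful packets stay in the queue and are retransmitted until success. $Y_k=1,0,\emptyset$ according as the transmission in slot $k$ succeeds, fails, or there is none ($Q_k=0$). The change point is a deterministic integer $\nu\ge1$: measurements are independent, with density $f_0$ if sampled in a slot $\le\nu$ and $f_1$ if sampled in a slot $>\nu$; the channel is memoryless with $P(Y_k=1\mid Q_k>0)=p_0$ for $k\le\nu$, $p_1$ for $k>\nu$, and, given $\nu$, independent of the sampling process; $r<\min\{p_0,p_1\}$. $\mathbb P_\nu$ is the law with change point $\nu$,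 $\mathbb P_\infty$ the law with no change. Measurements $X_1,X_2,\dots$ are indexed in order of sampling. $J_k$ is the sampling index of the measurement received in slot $k$ if $Y_k=1$ (and $J_k=*$ otherwise), and $Z_k=X_{J_k}$ if $Y_k=1$, $Z_k=*$ otherwise. $D_k$ is the number of measurements received up to the end of slot $k$. Disciplines: all disciplines are non-idling (a packet is attempted whenever the queue is nonempty), with preemption between attempts allowed. FCFS: packets are received in order of sampling. LCFS: in each slot the queued packet with the largest sampling index is transmitted. An alternate non-FCFS discipline is any other non-idling rule for the order of service. For the same arrival and channel-loss sequence, the queue lengths and departure instants are the same for all these disciplines; only the order of departures differs. CUSUM statistic: at the end of slot $k$ the DM rearranges the measurements received so far in increasing order of sampling index and assigns them in this order to the successive reception slots; $Z_k^{(i)}$ denotes the rearranged measurement assigned to reception slot $i\le k$. For $i\le k$ and $0\le s<i$, with the convention that the number of samples produced between slot 1 and the change is set to $0$ in the statistic, $$L_i(k)=\mathbf 1_{\{Q_i>0\}}\left(\log\frac{\mathbb P_s(Y_i\mid Q_i>0)}{\mathbb P_\infty(Y_i\mid Q_i>0)}+\mathbf 1_{\{Y_i=1,\ D_i>Q_1\}}\log\frac{f_1(Z_k^{(i)})}{f_0(Z_k^{(i)})}\right),\qquad \ell_{s,k}=\sum_{i=s+1}^kL_i(k),$$ (so the first logarithm is $\log\frac{p_1}{p_0}$ if $Y_i=1$ and $\log\frac{1-p_1}{1-p_0}$ if $Y_i=0$), and the CUSUM statistic is $C_m=\max_{1\le j\le m}\ell_{j,m}$. *)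

theory Defs
  imports "HOL-Probability.Probability" "HOL-Library.Extended_Nat"
begin

section \<open>Stochastic orders\<close>

definition is_density :: "(real \<Rightarrow> real) \<Rightarrow> bool" where
  "is_density f \<longleftrightarrow>
     f \<in> borel_measurable borel \<and> (\<forall>x. 0 \<le> f x) \<and> (\<integral>\<^sup>+x. ennreal (f x) \<partial>lborel) = 1"

definition supp :: "(real \<Rightarrow> real) \<Rightarrow> real set" where
  "supp f = {x. f x \<noteq> 0}"

definition lr_le :: "(real \<Rightarrow> real) \<Rightarrow> (real \<Rightarrow> real) \<Rightarrow> bool" where
  "lr_le f g \<longleftrightarrow>
     (\<forall>x \<in> supp f \<union> supp g. \<forall>y \<in> supp f \<union> supp g. x \<le> y \<longrightarrow> g x * f y \<le> f x * g y)"

definition st_le :: "'w measure \<Rightarrow> ('w \<Rightarrow> ereal) \<Rightarrow> ('w \<Rightarrow> ereal) \<Rightarrow> bool" where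
  "st_le M X Y \<longleftrightarrow>
     X \<in> borel_measurable M \<and> Y \<in> borel_measurable M \<and>
     (\<forall>x::real. measure M {\<omega> \<in> space M. ereal x < X \<omega>} \<le> measure M {\<omega> \<in> space M. ereal x < Y \<omega>})"


section \<open>Queueing along one sample path\<close>

text \<open>
  Slots are numbered from 1. A sample path is given by the initial queue length \<open>q\<close>,
  the arrival indicators \<open>a k\<close> and the channel states \<open>c k\<close>, where \<open>c k\<close> means that a
  transmission attempted in slot \<open>k\<close> succeeds. A packet is represented by the sampling index
  of its measurement: packets \<open>1..q\<close> are in the queue at the beginning of slot 1, and the
  packet produced in slot \<open>k\<close> gets index \<open>sampled q a k\<close> and can be served from slot
  \<open>k + 1\<close> on. The outcome \<open>None\<close> stands for the absence of a transmission.

  A service discipline sees the arrivals and outcomes of the past slots, the set of queued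
  indices and a randomisation seed, but neither the values of the measurements nor the future.
\<close>

type_synonym history = "(bool \<times> bool option) list"

type_synonym 'u discipline = "'u \<Rightarrow> history \<Rightarrow> nat set \<Rightarrow> nat"

definition service_discipline :: "'u measure \<Rightarrow> 'u discipline \<Rightarrow> bool" where
  "service_discipline US d \<longleftrightarrow>
     (\<forall>u \<in> space US. \<forall>h B. finite B \<and> B \<noteq> {} \<longrightarrow> d u h B \<in> B) \<and>
     (\<forall>h B. (\<lambda>u. d u h B) \<in> measurable US (count_space UNIV))"

definition fcfs :: "'u discipline" where
  "fcfs u h B = Min B"

definition lcfs :: "'u discipline" where
  "lcfs u h B = Max B"

definition sampled :: "nat \<Rightarrow> (nat \<Rightarrow> bool) \<Rightarrow> nat \<Rightarrow> nat" where
  "sampled q a k = q + card {i \<in> {1..k}. a i}"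

definition attempt :: "nat set \<Rightarrow> bool \<Rightarrow> bool option" where
  "attempt B s = (if B = {} then None else Some s)"

text \<open>History and queue content at the end of slot \<open>k\<close>, i.e. at the beginning of slot \<open>k + 1\<close>.\<close>

primrec run :: "nat \<Rightarrow> (nat \<Rightarrow> bool) \<Rightarrow> (nat \<Rightarrow> bool) \<Rightarrow> (history \<Rightarrow> nat set \<Rightarrow> nat) \<Rightarrow>
    nat \<Rightarrow> history \<times> nat set" where
  "run q a c d 0 = ([], {1..q})"
| "run q a c d (Suc k) =
     (let (h, B) = run q a c d k; y = attempt B (c (Suc k)) in
       (h @ [(a (Suc k), y)],
        (if y = Some True then B - {d h B} else B) \<union>
        (if a (Suc k) then {sampled q a (Suc k)} else {})))"

definition hist where
  "hist q a c d k = fst (run q a c d (k - 1))"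

definition queue where
  "queue q a c d k = snd (run q a c d (k - 1))"

definition queue_len :: "nat \<Rightarrow> (nat \<Rightarrow> bool) \<Rightarrow> (nat \<Rightarrow> bool) \<Rightarrow> (history \<Rightarrow> nat set \<Rightarrow> nat) \<Rightarrow>
    nat \<Rightarrow> nat" where
  "queue_len q a c d k = card (queue q a c d k)"

definition outcome where
  "outcome q a c d k = attempt (queue q a c d k) (c k)"

definition received_index :: "nat \<Rightarrow> (nat \<Rightarrow> bool) \<Rightarrow> (nat \<Rightarrow> bool) \<Rightarrow> (history \<Rightarrow> nat set \<Rightarrow> nat) \<Rightarrow>
    nat \<Rightarrow> nat option" where
  "received_index q a c d k =
     (if outcome q a c d k = Some True then Some (d (hist q a c d k) (queue q a c d k)) else None)"

definition departures where
  "departures q a c d k = card {i \<in> {1..k}. outcome q a c d i = Some True}"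

definition received where
  "received q a c d k = {j. \<exists>i \<in> {1..k}. received_index q a c d i = Some j}"

text \<open>
  \<open>x j\<close> is the value of the measurement with sampling index \<open>j\<close>. The \<open>n\<close>-th reception slot
  is assigned the measurement with the \<open>n\<close>-th smallest received index. Only meaningful if
  \<open>i \<le> k\<close> and slot \<open>i\<close> is a reception slot.
\<close>

definition Z_sorted :: "nat \<Rightarrow> (nat \<Rightarrow> bool) \<Rightarrow> (nat \<Rightarrow> bool) \<Rightarrow> (nat \<Rightarrow> real) \<Rightarrow>
    (history \<Rightarrow> nat set \<Rightarrow> nat) \<Rightarrow> nat \<Rightarrow> nat \<Rightarrow> real" where
  "Z_sorted q a c x d k i =
     x (sorted_list_of_set (received q a c d k) ! (departures q a c d i - 1))"


section \<open>The CUSUM statistic\<close>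

text \<open>
  Likelihood ratios may be 0 or infinite, so the statistic is extended-real valued.
  The value for \<open>0 / 0\<close> is irrelevant, as it occurs with probability 0. Infinite terms of
  opposite sign are added as in \<^typ>\<open>ereal\<close>, where \<open>\<infinity> + (-\<infinity>) = \<infinity>\<close>.
\<close>

definition log_ratio :: "real \<Rightarrow> real \<Rightarrow> ereal" where
  "log_ratio u v =
     (if u = 0 \<and> v = 0 then 0 else if v = 0 then \<infinity> else if u = 0 then -\<infinity> else ereal (ln (u / v)))"

definition success_prob :: "real \<Rightarrow> real \<Rightarrow> enat \<Rightarrow> nat \<Rightarrow> real" where
  "success_prob p0 p1 \<nu> k = (if enat k \<le> \<nu> then p0 else p1)"

definition outcome_prob :: "real \<Rightarrow> real \<Rightarrow> enat \<Rightarrow> nat \<Rightarrow> bool option \<Rightarrow> real" where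
  "outcome_prob p0 p1 \<nu> k y =
     (if y = Some True then success_prob p0 p1 \<nu> k else 1 - success_prob p0 p1 \<nu> k)"

definition llr where
  "llr p0 p1 f0 f1 q a c x d k s i =
     (if queue_len q a c d i > 0 then
        log_ratio (outcome_prob p0 p1 (enat s) i (outcome q a c d i)) (outcome_prob p0 p1 \<infinity> i (outcome q a c d i)) +
        (if outcome q a c d i = Some True \<and> departures q a c d i > q
         then log_ratio (f1 (Z_sorted q a c x d k i)) (f0 (Z_sorted q a c x d k i)) else 0)
      else 0)"

definition ell where
  "ell p0 p1 f0 f1 q a c x d s k = (\<Sum>i\<in>{s+1..k}. llr p0 p1 f0 f1 q a c x d k s i)"

definition cusum :: "real \<Rightarrow> real \<Rightarrow> (real \<Rightarrow> real) \<Rightarrow> (real \<Rightarrow> real) \<Rightarrow> nat \<Rightarrow>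
    (nat \<Rightarrow> bool) \<Rightarrow> (nat \<Rightarrow> bool) \<Rightarrow> (nat \<Rightarrow> real) \<Rightarrow> (history \<Rightarrow> nat set \<Rightarrow> nat) \<Rightarrow> nat \<Rightarrow> ereal" where
  "cusum p0 p1 f0 f1 q a c x d m = Max ((\<lambda>j. ell p0 p1 f0 f1 q a c x d j m) ` {1..m})"


section \<open>The random model\<close>

text \<open>
  \<open>A k\<close>: a measurement is taken in slot \<open>k\<close>; \<open>C k\<close>: an attempt in slot \<open>k\<close> succeeds;
  \<open>V k\<close>: the value of the measurement taken in slot \<open>k\<close>, if any; \<open>W j\<close>: the value of the
  measurement of the \<open>j\<close>-th packet queued initially, hence sampled before the change;
  \<open>U\<close>: the seed of a randomised service discipline. Placing the measurements in slots makes them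
  independent, whereas the density of the \<open>n\<close>-th measurement depends on its random sampling slot.
\<close>

datatype source = Arrival nat | Channel nat | Slot_Meas nat | Initial_Meas nat | Seed

definition source_sets where
  "source_sets M US A C V W U src = sets (case src of
       Arrival k \<Rightarrow> vimage_algebra (space M) (A k) (count_space (UNIV :: bool set))
     | Channel k \<Rightarrow> vimage_algebra (space M) (C k) (count_space (UNIV :: bool set))
     | Slot_Meas k \<Rightarrow> vimage_algebra (space M) (V k) (borel :: real measure)
     | Initial_Meas j \<Rightarrow> vimage_algebra (space M) (W j) (borel :: real measure)
     | Seed \<Rightarrow> vimage_algebra (space M) U US)"

text \<open>The law of the model with change point \<open>\<nu>\<close>; \<open>\<nu> = \<infinity>\<close> is the law without change.\<close>

locale sensor_model = prob_space M
  for M :: "'w measure" and US :: "'u measure"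
    and r p0 p1 :: real and f0 f1 :: "real \<Rightarrow> real" and \<nu> :: enat and q :: nat
    and A C :: "nat \<Rightarrow> 'w \<Rightarrow> bool" and V W :: "nat \<Rightarrow> 'w \<Rightarrow> real" and U :: "'w \<Rightarrow> 'u" +
  assumes r: "0 < r" "r < 1"
    and p: "r < min p0 p1" "p0 \<le> 1" "p1 \<le> 1"
    and densities: "is_density f0" "is_density f1"
    and nu: "1 \<le> \<nu>"
    and A_meas: "\<And>k. 1 \<le> k \<Longrightarrow> A k \<in> measurable M (count_space UNIV)"
    and C_meas: "\<And>k. 1 \<le> k \<Longrightarrow> C k \<in> measurable M (count_space UNIV)"
    and U_meas: "U \<in> measurable M US"
    and A_prob: "\<And>k. 1 \<le> k \<Longrightarrow> prob {\<omega> \<in> space M. A k \<omega>} = r"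
    and C_prob: "\<And>k. 1 \<le> k \<Longrightarrow> prob {\<omega> \<in> space M. C k \<omega>} = success_prob p0 p1 \<nu> k"
    and V_dist: "\<And>k. 1 \<le> k \<Longrightarrow>
      distributed M lborel (V k) (\<lambda>x. ennreal (if enat k \<le> \<nu> then f0 x else f1 x))"
    and W_dist: "\<And>j. j \<in> {1..q} \<Longrightarrow> distributed M lborel (W j) (\<lambda>x. ennreal (f0 x))"
    and indep: "indep_sets (source_sets M US A C V W U)
      (Arrival ` {1..} \<union> Channel ` {1..} \<union> Slot_Meas ` {1..} \<union> Initial_Meas ` {1..q} \<union> {Seed})"

definition sampling_slot :: "nat \<Rightarrow> (nat \<Rightarrow> bool) \<Rightarrow> nat \<Rightarrow> nat" where
  "sampling_slot q a n = (LEAST k. sampled q a k = n)"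

text \<open>The value of the measurement with sampling index \<open>n \<ge> 1\<close>.\<close>

definition meas :: "nat \<Rightarrow> (nat \<Rightarrow> 'w \<Rightarrow> bool) \<Rightarrow> (nat \<Rightarrow> 'w \<Rightarrow> real) \<Rightarrow> (nat \<Rightarrow> 'w \<Rightarrow> real) \<Rightarrow>
    nat \<Rightarrow> 'w \<Rightarrow> real" where
  "meas q A V W n \<omega> =
     (if n \<le> q then W n \<omega> else V (sampling_slot q (\<lambda>k. A k \<omega>) n) \<omega>)"

definition cusum_rv where
  "cusum_rv p0 p1 f0 f1 q A C V W U d m \<omega> =
     cusum p0 p1 f0 f1 q (\<lambda>k. A k \<omega>) (\<lambda>k. C k \<omega>) (\<lambda>n. meas q A V W n \<omega>) (d (U \<omega>)) m"

end

theory Submission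
  imports Defs
begin

text \<open>
  Given arrivals, channel states and seed, all disciplines have the same outcomes, and the CUSUM
  statistic is a nondecreasing function of the log-likelihood ratios of the received measurements
  sorted by sampling index. At every moment FCFS leaves the fewest and LCFS the most packets of
  index \<open>\<le> y\<close> in the queue, for all \<open>y\<close>; hence the \<open>n\<close>-th smallest received index is smallest
  under FCFS and largest under LCFS. A later sampling slot can only change the density of a
  measurement from \<open>f0\<close> to \<open>f1\<close>, and this increases the log-likelihood ratio stochastically.
  Independence of the measurements turns this into a domination of product measures with respect
  to upward closed sets; the statement then follows by conditioning on the (countably many)
  behaviours of the queue up to slot \<open>m\<close>.
\<close>

section \<open>Service disciplines along a sample path\<close>

text \<open>What remains of \<open>service_discipline\<close> once the seed is fixed; the path
  arguments use nothing else about a discipline.\<close>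

definition nonidling :: "(history \<Rightarrow> nat set \<Rightarrow> nat) \<Rightarrow> bool" where
  "nonidling d \<longleftrightarrow> (\<forall>h B. finite B \<and> B \<noteq> {} \<longrightarrow> d h B \<in> B)"

section \<open>Recursions along one sample path\<close>

lemma sampled_0 [simp]: "sampled q a 0 = q"
  by (simp add: sampled_def)

lemma sampled_Suc: "sampled q a (Suc k) = sampled q a k + (if a (Suc k) then 1 else 0)"
proof -
  have "{i \<in> {1..Suc k}. a i} = {i \<in> {1..k}. a i} \<union> (if a (Suc k) then {Suc k} else {})"
    by (auto simp: le_Suc_eq)
  then show ?thesis by (simp add: sampled_def)
qed

lemma sampled_mono: "i \<le> k \<Longrightarrow> sampled q a i \<le> sampled q a k"
  by (rule lift_Suc_mono_le[of "sampled q a"]) (simp add: sampled_Suc)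

lemma sampled_cong:
  assumes "\<And>i. 1 \<le> i \<Longrightarrow> i \<le> k \<Longrightarrow> a i = a' i"
  shows "sampled q a k = sampled q a' k"
proof -
  have "{i \<in> {1..k}. a i} = {i \<in> {1..k}. a' i}" using assms by auto
  then show ?thesis by (simp add: sampled_def)
qed

lemma outcome_Suc: "outcome q a c d (Suc k) = attempt (snd (run q a c d k)) (c (Suc k))"
  by (simp add: outcome_def queue_def)

lemma outcome_SomeTrue_iff:
  "outcome q a c d (Suc k) = Some True \<longleftrightarrow> snd (run q a c d k) \<noteq> {} \<and> c (Suc k)"
  by (simp add: outcome_Suc attempt_def)

lemma queue_Suc:
  "snd (run q a c d (Suc k)) =
     (if outcome q a c d (Suc k) = Some True
      then snd (run q a c d k) - {d (fst (run q a c d k)) (snd (run q a c d k))}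
      else snd (run q a c d k)) \<union> (if a (Suc k) then {Suc (sampled q a k)} else {})"
  by (simp add: outcome_Suc Let_def split_beta sampled_Suc)

declare run.simps(2) [simp del]

lemma queue_subset:
  assumes "nonidling d"
  shows "snd (run q a c d k) \<subseteq> {1..sampled q a k}"
proof (induction k)
  case 0
  then show ?case by simp
next
  case (Suc k)
  have "snd (run q a c d (Suc k)) \<subseteq> snd (run q a c d k) \<union> {sampled q a (Suc k)}"
    if "a (Suc k)" using that by (auto simp: queue_Suc sampled_Suc)
  moreover have "snd (run q a c d (Suc k)) \<subseteq> snd (run q a c d k)" if "\<not> a (Suc k)"
    using that by (auto simp: queue_Suc)
  ultimately show ?case
    using Suc sampled_Suc[of q a k] by (cases "a (Suc k)") force+
qed

lemma finite_queue: "nonidling d \<Longrightarrow> finite (snd (run q a c d k))"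
  by (rule finite_subset[OF queue_subset]) auto

lemma served_mem:
  assumes "nonidling d" "outcome q a c d (Suc k) = Some True"
  shows "d (fst (run q a c d k)) (snd (run q a c d k)) \<in> snd (run q a c d k)"
  using assms finite_queue[OF assms(1)] by (auto simp: nonidling_def outcome_SomeTrue_iff)

lemma received_Suc:
  "received q a c d (Suc k) = received q a c d k \<union>
     (if outcome q a c d (Suc k) = Some True
      then {d (fst (run q a c d k)) (snd (run q a c d k))} else {})"
proof -
  have "received_index q a c d (Suc k) = (if outcome q a c d (Suc k) = Some True
      then Some (d (fst (run q a c d k)) (snd (run q a c d k))) else None)"
    by (simp add: received_index_def hist_def queue_def)
  then show ?thesis by (auto simp: received_def atLeastAtMostSuc_conv)
qed

lemma departures_Suc:
  "departures q a c d (Suc k) =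
     departures q a c d k + (if outcome q a c d (Suc k) = Some True then 1 else 0)"
proof -
  have "{i \<in> {1..Suc k}. outcome q a c d i = Some True} =
    {i \<in> {1..k}. outcome q a c d i = Some True} \<union>
      (if outcome q a c d (Suc k) = Some True then {Suc k} else {})"
    by (auto simp: le_Suc_eq)
  then show ?thesis by (simp add: departures_def)
qed

lemma departures_mono: "i \<le> k \<Longrightarrow> departures q a c d i \<le> departures q a c d k"
  by (rule lift_Suc_mono_le[of "departures q a c d"]) (simp add: departures_Suc)

text \<open>Conservation of packets: a success moves one index from the queue to the received set,
  and an arrival adds the fresh index both to the range of sampled indices and to the queue.\<close>

lemma received_eq:
  assumes d: "nonidling d"
  shows "received q a c d k = {1..sampled q a k} - snd (run q a c d k)"
proof (induction k)
  case 0
  then show ?case by (simp add: received_def)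
next
  case (Suc k)
  let ?B = "snd (run q a c d k)" and ?N = "sampled q a k"
  have sub: "?B \<subseteq> {1..?N}" by (rule queue_subset[OF d])
  have b: "outcome q a c d (Suc k) = Some True \<Longrightarrow> d (fst (run q a c d k)) ?B \<in> {1..?N}"
    using served_mem[OF d] sub by blast
  \<comment> \<open>These facts split off the fresh index, which is neither in the old range nor
    queued.\<close>
  have N: "x \<in> {1..Suc ?N} \<longleftrightarrow> x = Suc ?N \<or> x \<in> {1..?N}" "Suc ?N \<notin> {1..?N}" "Suc ?N \<notin> ?B" for x
    using sub by auto
  show ?case
  proof (cases "a (Suc k)")
    case True
    then have S: "sampled q a (Suc k) = Suc ?N" by (simp add: sampled_Suc)
    show ?thesis
      unfolding received_Suc queue_Suc Suc.IH S set_eq_iff Un_iff Diff_iff N(1)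
      using b N(2,3) True by auto
  next
    case False
    then have S: "sampled q a (Suc k) = ?N" by (simp add: sampled_Suc)
    show ?thesis
      unfolding received_Suc queue_Suc Suc.IH S
      using b False by auto
  qed
qed

lemma finite_received: "nonidling d \<Longrightarrow> finite (received q a c d k)"
  by (simp add: received_eq)

lemma card_received:
  assumes d: "nonidling d"
  shows "card (received q a c d k) = departures q a c d k"
proof (induction k)
  case 0
  then show ?case by (simp add: received_def departures_def)
next
  case (Suc k)
  show ?case
  proof (cases "outcome q a c d (Suc k) = Some True")
    case True
    then have "d (fst (run q a c d k)) (snd (run q a c d k)) \<notin> received q a c d k"
      using served_mem[OF d True] unfolding received_eq[OF d] by simp
    then show ?thesis
      using Suc True finite_received[OF d] by (simp add: received_Suc departures_Suc)
  qed (simp add: Suc received_Suc departures_Suc)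
qed

lemma card_Un_if:
  "finite X \<Longrightarrow> b \<notin> X \<Longrightarrow> card (X \<union> (if P then {b} else {})) = card X + (if P then 1 else 0)"
  by simp

text \<open>The right-hand side mentions only the length, the arrival and the channel state. Hence
  queue lengths, and with them outcomes and departure counts, are common to all non-idling
  disciplines.\<close>

lemma card_queue_Suc:
  assumes d: "nonidling d"
  shows "card (snd (run q a c d (Suc k))) =
    card (snd (run q a c d k)) - (if card (snd (run q a c d k)) > 0 \<and> c (Suc k) then 1 else 0)
      + (if a (Suc k) then 1 else 0)"
proof -
  let ?B = "snd (run q a c d k)"
  define X where "X = (if outcome q a c d (Suc k) = Some True
      then ?B - {d (fst (run q a c d k)) ?B} else ?B)"
  have "X \<subseteq> ?B" by (auto simp: X_def)
  then have "finite X" "Suc (sampled q a k) \<notin> X"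
    using finite_queue[OF d, of q a c k] queue_subset[OF d, of q a c k]
    by (auto intro: finite_subset)
  moreover have "card X = card ?B - (if card ?B > 0 \<and> c (Suc k) then 1 else 0)"
    using finite_queue[OF d, of q a c k] served_mem[OF d, of q a c k]
    by (simp add: X_def outcome_SomeTrue_iff card_gt_0_iff card_Diff_singleton)
  ultimately show ?thesis
    unfolding queue_Suc X_def[symmetric] by (subst card_Un_if) simp_all
qed

lemma card_queue_eq:
  assumes "nonidling d" "nonidling d'"
  shows "card (snd (run q a c d k)) = card (snd (run q a c d' k))"
proof (induction k)
  case (Suc k)
  show ?case unfolding card_queue_Suc[OF assms(1)] card_queue_Suc[OF assms(2)] Suc ..
qed simp

lemma outcome_eq:
  assumes "nonidling d" "nonidling d'"
  shows "outcome q a c d k = outcome q a c d' k"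
  using card_queue_eq[OF assms, of q a c "k - 1"] finite_queue[OF assms(1), of q a c "k - 1"]
    finite_queue[OF assms(2), of q a c "k - 1"]
  by (auto simp: outcome_def queue_def attempt_def)

lemma queue_len_eq:
  assumes "nonidling d" "nonidling d'"
  shows "queue_len q a c d k = queue_len q a c d' k"
  unfolding queue_len_def queue_def by (rule card_queue_eq[OF assms])

lemma departures_eq:
  assumes "nonidling d" "nonidling d'"
  shows "departures q a c d k = departures q a c d' k"
  unfolding departures_def outcome_eq[OF assms] ..

section \<open>Queued packets of index up to a threshold\<close>

lemma card_remove_atMost:
  fixes B :: "nat set"
  assumes "finite B" "b \<in> B"
  shows "card ((B - {b}) \<inter> {..y}) = card (B \<inter> {..y}) - (if b \<le> y then 1 else 0)"
proof -
  have "(B - {b}) \<inter> {..y} = (B \<inter> {..y}) - (if b \<le> y then {b} else {})" by auto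
  then show ?thesis using assms by (simp add: card_Diff_singleton)
qed

lemma card_insert_atMost:
  fixes B :: "nat set"
  assumes "finite B" "b \<notin> B"
  shows "card ((B \<union> (if P then {b} else {})) \<inter> {..y}) =
    card (B \<inter> {..y}) + (if P \<and> b \<le> y then 1 else 0)"
proof -
  have "(B \<union> (if P then {b} else {})) \<inter> {..y} = (B \<inter> {..y}) \<union> (if P \<and> b \<le> y then {b} else {})"
    by auto
  then show ?thesis using assms by simp
qed

text \<open>For fixed \<open>y\<close> the count obeys a scalar recursion in which the discipline
  enters only by whether the served index is at most \<open>y\<close>. The subtraction is never
  truncated, since such a packet is itself counted.\<close>

lemma card_queue_atMost_Suc:
  assumes d: "nonidling d"
  shows "card (snd (run q a c d (Suc k)) \<inter> {..y}) =
    card (snd (run q a c d k) \<inter> {..y})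
     - (if outcome q a c d (Suc k) = Some True
          \<and> d (fst (run q a c d k)) (snd (run q a c d k)) \<le> y then 1 else 0)
     + (if a (Suc k) \<and> Suc (sampled q a k) \<le> y then 1 else 0)"
proof -
  have "Suc (sampled q a k) \<notin> snd (run q a c d k)"
    using queue_subset[OF d, of q a c k] by auto
  then show ?thesis
    using finite_queue[OF d, of q a c k] served_mem[OF d, of q a c k]
    by (simp add: queue_Suc card_insert_atMost card_remove_atMost)
qed

lemma nonidling_fcfs: "nonidling (fcfs u)"
  by (auto simp: nonidling_def fcfs_def)

lemma nonidling_lcfs: "nonidling (lcfs u)"
  by (auto simp: nonidling_def lcfs_def)

text \<open>FCFS serves an index up to \<open>y\<close> whenever one is queued. So at a success
  either its count drops by 1 and the other by at most 1, or its count is already 0. Arrivals add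
  the same to both.\<close>

lemma fcfs_card_queue_le:
  assumes d: "nonidling d"
  shows "card (snd (run q a c (fcfs u) k) \<inter> {..y}) \<le> card (snd (run q a c d k) \<inter> {..y})"
proof (induction k)
  case 0
  then show ?case by simp
next
  case (Suc k)
  let ?B = "snd (run q a c (fcfs u) k)"
  have fin: "finite ?B" by (rule finite_queue[OF nonidling_fcfs])
  have "card (?B \<inter> {..y}) = 0"
    if "outcome q a c (fcfs u) (Suc k) = Some True" "\<not> Min ?B \<le> y"
  proof -
    have "?B \<inter> {..y} = {}"
      using that(2) Min_le[OF fin] order.trans by blast
    then show ?thesis by simp
  qed
  then have "card (?B \<inter> {..y})
      - (if outcome q a c (fcfs u) (Suc k) = Some True \<and> Min ?B \<le> y then 1 else 0)
    \<le> card (snd (run q a c d k) \<inter> {..y})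
      - (if outcome q a c (fcfs u) (Suc k) = Some True
          \<and> d (fst (run q a c d k)) (snd (run q a c d k)) \<le> y then 1 else 0)"
    using Suc by (cases "Min ?B \<le> y") auto
  then show ?case
    unfolding card_queue_atMost_Suc[OF d] card_queue_atMost_Suc[OF nonidling_fcfs]
      outcome_eq[OF d nonidling_fcfs, of q a c "Suc k" u] fcfs_def[of u "fst (run q a c (fcfs u) k)"]
    by (rule add_right_mono)
qed

text \<open>LCFS serves an index up to \<open>y\<close> only when its whole queue lies in
  \<open>{..y}\<close>. Its count is then the common queue length, and after a success this length
  minus 1 bounds the other count too.\<close>

lemma lcfs_card_queue_ge:
  assumes d: "nonidling d"
  shows "card (snd (run q a c d k) \<inter> {..y}) \<le> card (snd (run q a c (lcfs u) k) \<inter> {..y})"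
proof (induction k)
  case 0
  then show ?case by simp
next
  case (Suc k)
  let ?B = "snd (run q a c (lcfs u) k)" and ?B' = "snd (run q a c d k)"
  let ?b = "d (fst (run q a c d k)) ?B'"
  have fin: "finite ?B" "finite ?B'" by (rule finite_queue[OF nonidling_lcfs] finite_queue[OF d])+
  have "card (?B' \<inter> {..y}) - (if ?b \<le> y then 1 else 0) \<le> card (?B \<inter> {..y}) - 1"
    if out: "outcome q a c d (Suc k) = Some True" and y: "Max ?B \<le> y"
  proof -
    have b: "?b \<in> ?B'" by (rule served_mem[OF d out])
    have "?B \<inter> {..y} = ?B" using fin y by (auto dest: Max_ge)
    moreover have "card ((?B' - {?b}) \<inter> {..y}) \<le> card (?B' - {?b})"
      using fin by (intro card_mono) auto
    moreover have "card ?B' = card ?B" by (rule card_queue_eq[OF d nonidling_lcfs])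
    ultimately show ?thesis
      using card_remove_atMost[OF fin(2) b] fin b by (simp add: card_Diff_singleton)
  qed
  then have "card (?B' \<inter> {..y})
      - (if outcome q a c d (Suc k) = Some True \<and> ?b \<le> y then 1 else 0)
    \<le> card (?B \<inter> {..y}) - (if outcome q a c d (Suc k) = Some True \<and> Max ?B \<le> y then 1 else 0)"
    using Suc by (cases "Max ?B \<le> y") (auto intro: order.trans[OF diff_le_self])
  then show ?case
    unfolding card_queue_atMost_Suc[OF d] card_queue_atMost_Suc[OF nonidling_lcfs]
      outcome_eq[OF d nonidling_lcfs, of q a c "Suc k" u] lcfs_def[of u "fst (run q a c (lcfs u) k)"]
    by (rule add_right_mono)
qed

section \<open>Order statistics of the received indices\<close>

lemma sorted_list_nth_le:
  fixes R R' :: "nat set"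
  assumes fin: "finite R" "finite R'" and i: "i < card R" "i < card R'"
    and le: "\<And>y. card (R' \<inter> {..y}) \<le> card (R \<inter> {..y})"
  shows "sorted_list_of_set R ! i \<le> sorted_list_of_set R' ! i"
proof (rule ccontr)
  let ?xs = "sorted_list_of_set R" and ?ys = "sorted_list_of_set R'"
  let ?y = "?ys ! i"
  assume neg: "\<not> ?xs ! i \<le> ?y"
  \<comment> \<open>Up to the threshold \<open>?y\<close> the set \<open>R'\<close> has at least
    \<open>i + 1\<close> elements, but \<open>R\<close> would have at most \<open>i\<close>, against
    the counting assumption.\<close>
  have "(\<lambda>j. ?ys ! j) ` {..i} \<subseteq> R' \<inter> {..?y}"
    using i fin sorted_nth_mono[of ?ys] nth_mem[of _ ?ys] by auto
  moreover have "inj_on (\<lambda>j. ?ys ! j) {..i}"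
    using i fin by (auto simp: inj_on_def nth_eq_iff_index_eq)
  ultimately have "card {..i} \<le> card (R' \<inter> {..?y})"
    using fin by (metis card_inj_on_le finite_Int)
  moreover have "R \<inter> {..?y} \<subseteq> (\<lambda>j. ?xs ! j) ` {..<i}"
  proof
    fix z assume z: "z \<in> R \<inter> {..?y}"
    then have "z \<in> set ?xs" using fin by simp
    then obtain j where j: "j < length ?xs" "z = ?xs ! j" by (metis in_set_conv_nth)
    have "j < i"
    proof (rule ccontr)
      assume "\<not> j < i"
      then have "?xs ! i \<le> ?xs ! j" using j by (intro sorted_nth_mono) auto
      then show False using z j neg by auto
    qed
    then show "z \<in> (\<lambda>j. ?xs ! j) ` {..<i}" using j by auto
  qed
  then have "card (R \<inter> {..?y}) \<le> i"
    by (metis card_lessThan finite_lessThan surj_card_le)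
  ultimately show False using le[of ?y] by simp
qed

text \<open>Positions start at 0, so the entries up to position \<open>i\<close> are
  \<open>i + 1\<close> distinct positive numbers bounded by the last of them.\<close>

lemma le_sorted_list_nth:
  fixes R :: "nat set"
  assumes "finite R" "i < card R" "0 \<notin> R"
  shows "i < sorted_list_of_set R ! i"
proof -
  let ?xs = "sorted_list_of_set R"
  have "(\<lambda>j. ?xs ! j) ` {..i} \<subseteq> {1..?xs ! i}"
    using assms sorted_nth_mono[of ?xs] nth_mem[of _ ?xs]
    by (auto simp: Suc_le_eq) (metis gr0I le_less_trans nth_mem set_sorted_list_of_set length_sorted_list_of_set)
  moreover have "inj_on (\<lambda>j. ?xs ! j) {..i}"
    using assms by (auto simp: inj_on_def nth_eq_iff_index_eq)
  ultimately have "card {..i} \<le> card {1..?xs ! i}"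
    by (metis card_inj_on_le finite_atLeastAtMost)
  then show ?thesis by simp
qed

text \<open>Passing to the complement reverses the comparison of disciplines: fewer packets waiting
  up to \<open>y\<close> means more received.\<close>

lemma card_received_atMost:
  assumes d: "nonidling d"
  shows "card (received q a c d k \<inter> {..y}) =
    card ({1..sampled q a k} \<inter> {..y}) - card (snd (run q a c d k) \<inter> {..y})"
proof -
  have "received q a c d k \<inter> {..y} =
    ({1..sampled q a k} \<inter> {..y}) - (snd (run q a c d k) \<inter> {..y})"
    by (auto simp: received_eq[OF d])
  moreover have "snd (run q a c d k) \<inter> {..y} \<subseteq> {1..sampled q a k} \<inter> {..y}"
    by (rule Int_mono[OF queue_subset[OF d] order.refl])
  ultimately show ?thesis
    by (simp add: card_Diff_subset finite_queue[OF d])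
qed

text \<open>\<open>n\<close> is a departure count and starts at 1, while list positions start at 0.
  At a reception slot \<open>i\<close>, \<open>Z_sorted\<close> evaluates the measurement with this
  index for \<open>n = departures q a c d i\<close>.\<close>

definition nth_received ::
    "nat \<Rightarrow> (nat \<Rightarrow> bool) \<Rightarrow> (nat \<Rightarrow> bool) \<Rightarrow> (history \<Rightarrow> nat set \<Rightarrow> nat) \<Rightarrow> nat \<Rightarrow> nat \<Rightarrow> nat" where
  "nth_received q a c d k n = sorted_list_of_set (received q a c d k) ! (n - 1)"

lemma nth_received_mono:
  assumes d: "nonidling d" "nonidling d'"
    and le: "\<And>y. card (snd (run q a c d k) \<inter> {..y}) \<le> card (snd (run q a c d' k) \<inter> {..y})"
    and n: "1 \<le> n" "n \<le> departures q a c d k"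
  shows "nth_received q a c d k n \<le> nth_received q a c d' k n"
  unfolding nth_received_def
proof (rule sorted_list_nth_le)
  show "card (received q a c d' k \<inter> {..y}) \<le> card (received q a c d k \<inter> {..y})" for y
    unfolding card_received_atMost[OF d(1)] card_received_atMost[OF d(2)]
    using le by (intro diff_le_mono2)
qed (use n d departures_eq[OF d, of q a c k] in \<open>auto simp: card_received finite_received\<close>)

text \<open>The lower bound serves to exclude initial packets: for \<open>n > q\<close> the index
  exceeds \<open>q\<close>, so the measurement was taken in a slot.\<close>

lemma nth_received_mem:
  assumes d: "nonidling d" and n: "1 \<le> n" "n \<le> departures q a c d k"
  shows "nth_received q a c d k n \<in> {n..sampled q a k}"
proof -
  have "n - 1 < card (received q a c d k)" using n d by (simp add: card_received)
  then have "nth_received q a c d k n \<in> received q a c d k"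
    unfolding nth_received_def
    by (metis finite_received[OF d] length_sorted_list_of_set nth_mem set_sorted_list_of_set)
  moreover have "n - 1 < nth_received q a c d k n" unfolding nth_received_def
  proof (rule le_sorted_list_nth)
    show "0 \<notin> received q a c d k" by (simp add: received_eq[OF d])
  qed (use n d in \<open>auto simp: card_received finite_received\<close>)
  ultimately show ?thesis by (auto simp: received_eq[OF d])
qed

lemma inj_on_nth_received:
  assumes d: "nonidling d"
  shows "inj_on (nth_received q a c d k) {1..departures q a c d k}"
  using d by (intro inj_onI)
    (auto simp: nth_received_def nth_eq_iff_index_eq finite_received card_received)

section \<open>Slots in which measurements were taken\<close>

lemma sampling_slot:
  assumes "q < n" "n \<le> sampled q a k"
  shows "sampled q a (sampling_slot q a n) = n" "sampling_slot q a n \<in> {1..k}"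
proof -
  \<comment> \<open>The count climbs from \<open>q\<close> in steps of at most 1, so it attains
    every value in between.\<close>
  have "\<exists>i\<le>k. sampled q a i = n"
    using assms(2)
  proof (induction k)
    case 0
    then show ?case using assms by simp
  next
    case (Suc k)
    show ?case
    proof (cases "n \<le> sampled q a k")
      case True
      then show ?thesis using Suc by (meson le_SucI)
    next
      case False
      then have "sampled q a (Suc k) = n" using Suc by (simp add: sampled_Suc split: if_splits)
      then show ?thesis by blast
    qed
  qed
  then obtain i where i: "i \<le> k" "sampled q a i = n" by blast
  show *: "sampled q a (sampling_slot q a n) = n"
    unfolding sampling_slot_def by (rule LeastI[where P="\<lambda>i. sampled q a i = n"]) (rule i)
  have "sampling_slot q a n \<le> i" unfolding sampling_slot_def using i by (intro Least_le)
  \<comment> \<open>At slot 0 the count is still \<open>q\<close>, which is below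
    \<open>n\<close>.\<close>
  moreover have "sampling_slot q a n \<noteq> 0" using * assms by (metis less_irrefl sampled_0)
  ultimately show "sampling_slot q a n \<in> {1..k}" using i by auto
qed

lemma sampling_slot_mono:
  assumes "q < n" "n \<le> n'" "n' \<le> sampled q a k"
  shows "sampling_slot q a n \<le> sampling_slot q a n'"
proof (rule ccontr)
  assume neg: "\<not> ?thesis"
  have s: "sampled q a (sampling_slot q a n) = n" "sampled q a (sampling_slot q a n') = n'"
    using assms by (auto intro!: sampling_slot(1)[of _ _ _ k])
  then have "n' \<le> n" using sampled_mono[of "sampling_slot q a n'" "sampling_slot q a n" q a] neg by simp
  then show False using neg assms by simp
qed

text \<open>The \<open>LEAST\<close> ranges over all slots, but it is attained within the first
  \<open>k\<close>, where both counts agree.\<close>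

lemma sampling_slot_cong:
  assumes eq: "\<And>i. 1 \<le> i \<Longrightarrow> i \<le> k \<Longrightarrow> a i = a' i" and n: "q < n" "n \<le> sampled q a k"
  shows "sampling_slot q a n = sampling_slot q a' n"
proof -
  have s: "sampled q a i = sampled q a' i" if "i \<le> k" for i
    using that eq by (intro sampled_cong) auto
  have n': "n \<le> sampled q a' k" using s n by simp
  note 1 = sampling_slot[OF n] and 2 = sampling_slot[OF n(1) n']
  show ?thesis
  proof (rule antisym)
    show "sampling_slot q a n \<le> sampling_slot q a' n"
      unfolding sampling_slot_def[of q a] using 2 s by (intro Least_le) auto
    show "sampling_slot q a' n \<le> sampling_slot q a n"
      unfolding sampling_slot_def[of q a'] using 1 s by (intro Least_le) auto
  qed
qed

section \<open>Dependence on finitely many data\<close>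

definition states :: "nat \<Rightarrow> nat \<Rightarrow> (history \<times> nat set) set" where
  "states q m = {h. length h \<le> m} \<times> Pow {1..q + m}"

text \<open>Histories are lists over a finite alphabet and queues are subsets of a bounded range.
  Finiteness lets the choices of a discipline up to slot \<open>m\<close> be recorded in a
  list.\<close>

lemma finite_states: "finite (states q m)"
  using finite_lists_length_le[of "UNIV :: (bool \<times> bool option) set" m]
  by (simp add: states_def)

lemma run_in_states:
  assumes "nonidling d" "k \<le> m"
  shows "run q a c d k \<in> states q m"
proof -
  have "length (fst (run q a c d k)) = k"
    by (induction k) (simp_all add: run.simps(2) Let_def split_beta)
  moreover have "sampled q a k \<le> q + m"
  proof -
    have "card {i \<in> {1..k}. a i} \<le> card {1..k}" by (intro card_mono) auto
    then show ?thesis using assms by (simp add: sampled_def)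
  qed
  ultimately show ?thesis
    using queue_subset[OF assms(1), of q a c k] assms(2)
    by (force simp: states_def mem_Times_iff)
qed

context
  fixes q m :: nat and a a' c c' :: "nat \<Rightarrow> bool" and d d' :: "history \<Rightarrow> nat set \<Rightarrow> nat"
  assumes d: "nonidling d"
    and a_eq: "\<And>i. 1 \<le> i \<Longrightarrow> i \<le> m \<Longrightarrow> a i = a' i"
    and c_eq: "\<And>i. 1 \<le> i \<Longrightarrow> i \<le> m \<Longrightarrow> c i = c' i"
    and d_eq: "\<And>h B. (h, B) \<in> states q m \<Longrightarrow> d h B = d' h B"
begin

text \<open>The discipline is consulted only at states that the run has reached, and these lie in
  \<open>states q m\<close>.\<close>

lemma run_cong: "k \<le> m \<Longrightarrow> run q a c d k = run q a' c' d' k"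
proof (induction k)
  case (Suc k)
  obtain h B where hB: "run q a c d k = (h, B)" by fastforce
  have "(h, B) \<in> states q m" using run_in_states[OF d, of k m q a c] Suc hB by simp
  moreover have "sampled q a (Suc k) = sampled q a' (Suc k)"
    using Suc a_eq by (intro sampled_cong) auto
  moreover have "run q a' c' d' k = (h, B)" using Suc hB by simp
  ultimately show ?case
    using Suc.prems hB a_eq[of "Suc k"] c_eq[of "Suc k"] d_eq[of h B]
    by (simp add: run.simps(2) Let_def)
qed simp

lemma outcome_cong:
  assumes "1 \<le> i" "i \<le> m"
  shows "outcome q a c d i = outcome q a' c' d' i"
  using assms run_cong[of "i - 1"] c_eq by (simp add: outcome_def queue_def)

lemma queue_len_cong: "i \<le> m \<Longrightarrow> queue_len q a c d i = queue_len q a' c' d' i"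
  using run_cong[of "i - 1"] by (simp add: queue_len_def queue_def)

lemma departures_cong: 
  assumes "i \<le> m" shows "departures q a c d i = departures q a' c' d' i"
proof -
  have "{j \<in> {1..i}. outcome q a c d j = Some True} = {j \<in> {1..i}. outcome q a' c' d' j = Some True}"
    using assms outcome_cong by auto
  then show ?thesis by (simp add: departures_def)
qed

lemma received_cong: "received q a c d m = received q a' c' d' m"
proof -
  have "received_index q a c d i = received_index q a' c' d' i" if i: "i \<in> {1..m}" for i
  proof -
    have "run q a c d (i - 1) \<in> states q m" using i by (intro run_in_states[OF d]) auto
    then show ?thesis
      using i run_cong[of "i - 1", symmetric] outcome_cong[of i]
        d_eq[of "fst (run q a c d (i - 1))" "snd (run q a c d (i - 1))"]
      by (auto simp: received_index_def hist_def queue_def)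
  qed
  then show ?thesis unfolding received_def by auto
qed

end

text \<open>The CUSUM statistic as a function of the value \<open>z n\<close> assigned to the \<open>n\<close>-th reception slot.\<close>

definition cusum_of where
  "cusum_of p0 p1 f0 f1 q a c d m z =
     Max ((\<lambda>s. \<Sum>i\<in>{s+1..m}.
       if queue_len q a c d i > 0 then
         log_ratio (outcome_prob p0 p1 (enat s) i (outcome q a c d i))
           (outcome_prob p0 p1 \<infinity> i (outcome q a c d i)) +
         (if outcome q a c d i = Some True \<and> departures q a c d i > q
          then log_ratio (f1 (z (departures q a c d i))) (f0 (z (departures q a c d i))) else 0)
       else 0) ` {1..m})"

lemma cusum_eq_cusum_of:
  "cusum p0 p1 f0 f1 q a c x d m =
     cusum_of p0 p1 f0 f1 q a c d m (\<lambda>n. x (nth_received q a c d m n))"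
  unfolding cusum_def cusum_of_def ell_def llr_def Z_sorted_def nth_received_def ..

text \<open>At fixed assigned values \<open>z\<close> the statistic sees a discipline only through
  queue lengths, outcomes and departure counts. So two disciplines can differ only in
  \<open>z\<close>.\<close>

lemma cusum_of_discipline:
  assumes "nonidling d" "nonidling d'"
  shows "cusum_of p0 p1 f0 f1 q a c d m z = cusum_of p0 p1 f0 f1 q a c d' m z"
  unfolding cusum_of_def queue_len_eq[OF assms] outcome_eq[OF assms] departures_eq[OF assms] ..

text \<open>Every assigned value enters through its log-likelihood ratio as a summand, and addition
  on \<open>ereal\<close> is monotone also at infinite values.\<close>

lemma cusum_of_mono:
  assumes m: "1 \<le> m"
    and le: "\<And>n. n \<in> {q<..departures q a c d m} \<Longrightarrow>
      log_ratio (f1 (z n)) (f0 (z n)) \<le> log_ratio (f1 (z' n)) (f0 (z' n))"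
  shows "cusum_of p0 p1 f0 f1 q a c d m z \<le> cusum_of p0 p1 f0 f1 q a c d m z'"
proof -
  define F where "F = (\<lambda>z i s. if queue_len q a c d i > 0 then
         log_ratio (outcome_prob p0 p1 (enat s) i (outcome q a c d i))
           (outcome_prob p0 p1 \<infinity> i (outcome q a c d i)) +
         (if outcome q a c d i = Some True \<and> departures q a c d i > q
          then log_ratio (f1 (z (departures q a c d i))) (f0 (z (departures q a c d i))) else 0)
       else 0)"
  have "F z i s \<le> F z' i s" if "i \<le> m" for i s
    using le[of "departures q a c d i"] departures_mono[OF that, of q a c d]
    by (auto simp: F_def intro!: add_mono)
  then have s: "(\<Sum>i\<in>{s+1..m}. F z i s) \<le> (\<Sum>i\<in>{s+1..m}. F z' i s)" for s
    by (intro sum_mono) auto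
  have "Max ((\<lambda>s. \<Sum>i\<in>{s+1..m}. F z i s) ` {1..m}) \<le> Max ((\<lambda>s. \<Sum>i\<in>{s+1..m}. F z' i s) ` {1..m})"
  proof (rule Max.boundedI)
    fix v assume "v \<in> (\<lambda>s. \<Sum>i\<in>{s+1..m}. F z i s) ` {1..m}"
    then obtain t where t: "t \<in> {1..m}" "v = (\<Sum>i\<in>{t+1..m}. F z i t)" by blast
    have "v \<le> (\<Sum>i\<in>{t+1..m}. F z' i t)" using s t by simp
    also have "\<dots> \<le> Max ((\<lambda>s. \<Sum>i\<in>{s+1..m}. F z' i s) ` {1..m})" using t by (intro Max_ge) auto
    finally show "v \<le> Max ((\<lambda>s. \<Sum>i\<in>{s+1..m}. F z' i s) ` {1..m})" .
  qed (use m in auto)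
  then show ?thesis unfolding cusum_of_def F_def .
qed

text \<open>Monotonicity in both directions.\<close>

lemma cusum_of_cong:
  assumes "1 \<le> m" "\<And>n. n \<in> {q<..departures q a c d m} \<Longrightarrow> z n = z' n"
  shows "cusum_of p0 p1 f0 f1 q a c d m z = cusum_of p0 p1 f0 f1 q a c d m z'"
  using assms by (intro antisym cusum_of_mono) auto

lemma cusum_of_path_cong:
  assumes "nonidling d" "\<And>i. 1 \<le> i \<Longrightarrow> i \<le> m \<Longrightarrow> a i = a' i" "\<And>i. 1 \<le> i \<Longrightarrow> i \<le> m \<Longrightarrow> c i = c' i"
    "\<And>h B. (h, B) \<in> states q m \<Longrightarrow> d h B = d' h B"
  shows "cusum_of p0 p1 f0 f1 q a c d m z = cusum_of p0 p1 f0 f1 q a' c' d' m z"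
  unfolding cusum_of_def
  using outcome_cong[OF assms] queue_len_cong[OF assms] departures_cong[OF assms]
  by (intro arg_cong[where f=Max] image_cong sum.cong refl) auto

section \<open>Measurability of the statistic\<close>

lemma borel_measurable_log_ratio [measurable]:
  assumes [measurable]: "u \<in> borel_measurable M" "v \<in> borel_measurable M"
  shows "(\<lambda>x. log_ratio (u x) (v x)) \<in> borel_measurable M"
  unfolding log_ratio_def by measurable

lemma borel_measurable_cusum_of:
  fixes f0 f1 :: "real \<Rightarrow> real"
  assumes [measurable]: "f0 \<in> borel_measurable borel" "f1 \<in> borel_measurable borel"
    and m: "1 \<le> m"
    and X: "\<And>n::nat. n \<in> {q<..departures q a c d m} \<Longrightarrow> (\<lambda>\<omega>. X \<omega> n) \<in> borel_measurable N"
  shows "(\<lambda>\<omega>. cusum_of p0 p1 f0 f1 q a c d m (X \<omega>)) \<in> borel_measurable N"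
proof -
  \<comment> \<open>Coordinates that the statistic does not read are set to 0, because nothing is
    known about their measurability.\<close>
  define Y where "Y \<omega> n = (if n \<in> {q<..departures q a c d m} then X \<omega> n else 0)" for \<omega> n
  have [measurable]: "(\<lambda>\<omega>. Y \<omega> n) \<in> borel_measurable N" for n
    using X by (cases "n \<in> {q<..departures q a c d m}") (auto simp: Y_def)
  have "cusum_of p0 p1 f0 f1 q a c d m (X \<omega>) = cusum_of p0 p1 f0 f1 q a c d m (Y \<omega>)" for \<omega>
    using m by (intro cusum_of_cong) (auto simp: Y_def)
  moreover have "(\<lambda>\<omega>. cusum_of p0 p1 f0 f1 q a c d m (Y \<omega>)) \<in> borel_measurable N"
    unfolding cusum_of_def by measurable
  ultimately show ?thesis by simp
qed

section \<open>Stochastic domination of product measures\<close>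

text \<open>\<open>R\<close> is an arbitrary relation: the one used later compares points by their
  log-likelihood ratios and is in general not antisymmetric.\<close>

definition upset where
  "upset R \<Omega> S \<longleftrightarrow> S \<subseteq> \<Omega> \<and> (\<forall>x\<in>S. \<forall>y\<in>\<Omega>. R x y \<longrightarrow> y \<in> S)"

text \<open>
  If \<open>f1 \<le> f0\<close> at some point of \<open>S\<close>, then \<open>f1 \<le> f0\<close> outside of \<open>S\<close>; otherwise \<open>f0 < f1\<close> on \<open>S\<close>.
\<close>

lemma density_upset_le:
  assumes f: "is_density f0" "is_density f1" and S: "S \<in> sets borel"
    and up: "\<And>x y. x \<in> S \<Longrightarrow> log_ratio (f1 x) (f0 x) \<le> log_ratio (f1 y) (f0 y) \<Longrightarrow> y \<in> S"
  shows "emeasure (density lborel f0) S \<le> emeasure (density lborel f1) S"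
proof -
  have [measurable]: "f0 \<in> borel_measurable borel" "f1 \<in> borel_measurable borel" "S \<in> sets borel"
    and pos: "\<And>x. 0 \<le> f0 x" "\<And>x. 0 \<le> f1 x"
    and one: "(\<integral>\<^sup>+x. f0 x \<partial>lborel) = 1" "(\<integral>\<^sup>+x. f1 x \<partial>lborel) = 1"
    using f S by (auto simp: is_density_def)
  \<comment> \<open>The convention for \<open>0 / 0\<close> fits, since then both sides
    hold.\<close>
  have le0: "log_ratio (f1 x) (f0 x) \<le> 0 \<longleftrightarrow> f1 x \<le> f0 x" for x
  proof -
    have "ln (f1 x / f0 x) \<le> 0 \<longleftrightarrow> f1 x \<le> f0 x" if "f1 x \<noteq> 0" "f0 x \<noteq> 0"
      using that pos[of x] by (subst ln_le_zero_iff) (auto simp: field_simps)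
    then show ?thesis using pos[of x] by (auto simp: log_ratio_def)
  qed
  show ?thesis
  proof (cases "\<exists>x\<in>S. f1 x \<le> f0 x")
    case True
    then obtain x where x: "x \<in> S" "f1 x \<le> f0 x" by blast
    \<comment> \<open>A point outside \<open>S\<close> has a strictly smaller ratio than
      \<open>x\<close>, because the order on \<open>ereal\<close> is total.\<close>
    have out: "f1 y \<le> f0 y" if "y \<notin> S" for y
      using up[OF x(1), of y] that x(2) le0[of x] le0[of y] by (meson linear order.trans)
    let ?D0 = "density lborel f0" and ?D1 = "density lborel f1"
    interpret D0: prob_space ?D0
      by (rule prob_spaceI) (simp add: emeasure_density one)
    interpret D1: prob_space ?D1
      by (rule prob_spaceI) (simp add: emeasure_density one)
    \<comment> \<open>The comparison is made on the complement and then reversed, as both measures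
      have total mass 1.\<close>
    have "emeasure ?D1 (- S) \<le> emeasure ?D0 (- S)"
      using out by (auto simp: emeasure_density split: split_indicator intro!: nn_integral_mono ennreal_leI)
    then have "D1.prob (- S) \<le> D0.prob (- S)"
      by (simp add: D0.emeasure_eq_measure D1.emeasure_eq_measure)
    then have "D0.prob S \<le> D1.prob S"
      using D0.prob_compl[of S] D1.prob_compl[of S] by (simp add: Compl_eq_Diff_UNIV)
    then show ?thesis
      by (simp add: D0.emeasure_eq_measure D1.emeasure_eq_measure)
  next
    case False
    then show ?thesis
      by (auto simp: emeasure_density not_le less_imp_le split: split_indicator
        intro!: nn_integral_mono ennreal_leI)
  qed
qed

text \<open>
  The induction exchanges one factor at a time, by Fubini. The factors in \<open>I\<close> are exchanged first,
  for a fixed value of the factor \<open>i\<close>: the sections of \<open>S\<close> are again upward closed.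
\<close>

lemma emeasure_PiM_upset_le:
  fixes P Q :: "'i \<Rightarrow> 'a measure" and N :: "'a measure" and R :: "'a \<Rightarrow> 'a \<Rightarrow> bool"
  assumes prob: "\<And>i. prob_space (P i)" "\<And>i. prob_space (Q i)"
    and sets: "\<And>i. sets (P i) = sets N" "\<And>i. sets (Q i) = sets N"
    and R_refl: "\<And>x. R x x"
    and le: "\<And>i T. i \<in> I \<Longrightarrow> T \<in> sets N \<Longrightarrow> upset R (space N) T \<Longrightarrow> emeasure (P i) T \<le> emeasure (Q i) T"
    and I: "finite I"
    and S: "S \<in> sets (PiM I (\<lambda>_. N))" "upset (\<lambda>x y. \<forall>i\<in>I. R (x i) (y i)) (space (PiM I (\<lambda>_. N))) S"
  shows "emeasure (PiM I P) S \<le> emeasure (PiM I Q) S"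
  using I le S
proof (induction I arbitrary: S)
  case empty
  have "PiM {} P = PiM {} Q" by (simp add: PiM_empty)
  then show ?case by simp
next
  case (insert i I)
  interpret P: product_sigma_finite P
    by (intro product_sigma_finite.intro prob_space_imp_sigma_finite prob)
  interpret Q: product_sigma_finite Q
    by (intro product_sigma_finite.intro prob_space_imp_sigma_finite prob)
  have spaces: "space (P i) = space N" "space (Q i) = space N" for i
    by (rule sets_eq_imp_space_eq, rule sets)+
  have setsPi: "sets (PiM J P) = sets (PiM J (\<lambda>_. N))" "sets (PiM J Q) = sets (PiM J (\<lambda>_. N))" for J
    by (intro sets_PiM_cong refl sets)+
  have spPi: "space (PiM J P) = space (PiM J (\<lambda>_. N))" "space (PiM J Q) = space (PiM J (\<lambda>_. N))" for J
    by (intro sets_eq_imp_space_eq setsPi)+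
  have measPi: "measurable (PiM J P) = measurable (PiM J (\<lambda>_. N))" "measurable (PiM J Q) = measurable (PiM J (\<lambda>_. N))" for J
    by (intro ext measurable_cong_sets setsPi refl)+
  define h :: "('i \<Rightarrow> 'a) \<Rightarrow> ennreal" where "h = indicator S"
  note [measurable] = insert.prems(2)
  have h: "h \<in> borel_measurable (PiM (insert i I) (\<lambda>_. N))" unfolding h_def by measurable
  have upd: "(\<lambda>(x, y). x(i := y)) \<in> PiM I (\<lambda>_. N) \<Otimes>\<^sub>M N \<rightarrow>\<^sub>M PiM (insert i I) (\<lambda>_. N)"
    using measurable_add_dim[of i I "\<lambda>_. N"] by simp
  have S_up: "y \<in> S" if "x \<in> S" "y \<in> space (PiM (insert i I) (\<lambda>_. N))" "\<forall>j\<in>insert i I. R (x j) (y j)" for x y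
    using insert.prems(3) that unfolding upset_def by blast
  have ins: "x(i := y) \<in> space (PiM (insert i I) (\<lambda>_. N))" if "x \<in> space (PiM I (\<lambda>_. N))" "y \<in> space N" for x y
    using that by (auto simp: space_PiM PiE_iff extensional_def)
  have 1: "(\<integral>\<^sup>+x. h (x(i := y)) \<partial>PiM I P) \<le> (\<integral>\<^sup>+x. h (x(i := y)) \<partial>PiM I Q)" if y: "y \<in> space N" for y
  proof -
    define T where "T = (\<lambda>x. x(i := y)) -` S \<inter> space (PiM I (\<lambda>_. N))"
    have "(\<lambda>x. x(i := y)) \<in> PiM I (\<lambda>_. N) \<rightarrow>\<^sub>M PiM (insert i I) (\<lambda>_. N)"
      using measurable_compose[OF measurable_Pair2' upd] y
        measurable_compose[OF measurable_Pair1' upd] by simp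
    then have T: "T \<in> sets (PiM I (\<lambda>_. N))" unfolding T_def by (rule measurable_sets) (rule insert.prems(2))
    have "emeasure (PiM I P) T \<le> emeasure (PiM I Q) T"
    proof (rule insert.IH)
      show "upset (\<lambda>x y. \<forall>i\<in>I. R (x i) (y i)) (space (PiM I (\<lambda>_. N))) T"
        unfolding upset_def
      proof (intro conjI ballI impI)
        fix x x' assume "x \<in> T" "x' \<in> space (PiM I (\<lambda>_. N))" "\<forall>j\<in>I. R (x j) (x' j)"
        \<comment> \<open>Both points carry the same \<open>y\<close> at coordinate
          \<open>i\<close>, so reflexivity of \<open>R\<close> supplies the comparison
          there.\<close>
        then show "x' \<in> T"
          using S_up[of "x(i := y)" "x'(i := y)"] ins[of x' y] y R_refl by (auto simp: T_def)
      qed (auto simp: T_def)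
    qed (use insert.prems T in auto)
    note le_T = this
    have ind: "h (x(i := y)) = indicator T x" if "x \<in> space (PiM I (\<lambda>_. N))" for x
      using that by (simp add: h_def T_def split: split_indicator)
    have "(\<integral>\<^sup>+x. h (x(i := y)) \<partial>PiM I P) = (\<integral>\<^sup>+x. indicator T x \<partial>PiM I P)"
      "(\<integral>\<^sup>+x. h (x(i := y)) \<partial>PiM I Q) = (\<integral>\<^sup>+x. indicator T x \<partial>PiM I Q)"
      by (rule nn_integral_cong, simp add: spPi ind)+
    then show ?thesis using le_T T by (simp add: setsPi)
  qed
  have 2: "(\<integral>\<^sup>+y. h (x(i := y)) \<partial>P i) \<le> (\<integral>\<^sup>+y. h (x(i := y)) \<partial>Q i)"
    if x: "x \<in> space (PiM I (\<lambda>_. N))" for x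
  proof -
    define T where "T = (\<lambda>y. x(i := y)) -` S \<inter> space N"
    have "(\<lambda>y. x(i := y)) \<in> N \<rightarrow>\<^sub>M PiM (insert i I) (\<lambda>_. N)"
      using measurable_compose[OF measurable_Pair1' upd] x by simp
    then have T: "T \<in> sets N" unfolding T_def by (rule measurable_sets) (rule insert.prems(2))
    have "emeasure (P i) T \<le> emeasure (Q i) T"
    proof (rule insert.prems(1))
      show "upset R (space N) T"
        unfolding upset_def
      proof (intro conjI ballI impI)
        fix y y' assume "y \<in> T" "y' \<in> space N" "R y y'"
        then show "y' \<in> T"
          using S_up[of "x(i := y)" "x(i := y')"] ins[of x y'] x R_refl by (auto simp: T_def)
      qed (auto simp: T_def)
    qed (use T in auto)
    note le_T = this
    have ind: "h (x(i := y)) = indicator T y" if "y \<in> space N" for y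
      using that by (simp add: h_def T_def split: split_indicator)
    have "(\<integral>\<^sup>+y. h (x(i := y)) \<partial>P i) = (\<integral>\<^sup>+y. indicator T y \<partial>P i)"
      "(\<integral>\<^sup>+y. h (x(i := y)) \<partial>Q i) = (\<integral>\<^sup>+y. indicator T y \<partial>Q i)"
      by (rule nn_integral_cong, simp add: spaces ind)+
    then show ?thesis using le_T T by (simp add: sets)
  qed
  \<comment> \<open>Intermediate family: the factors in \<open>I\<close> are already exchanged,
    factor \<open>i\<close> is not yet. Fubini for it, in either order, links the two
    exchanges.\<close>
  define PQ where "PQ j = (if j = i then P i else Q j)" for j
  interpret PQ: product_sigma_finite PQ
    by (rule product_sigma_finite.intro) (simp add: PQ_def prob_space_imp_sigma_finite prob)
  have PQI: "PiM I PQ = PiM I Q"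
    using insert.hyps by (intro PiM_cong) (auto simp: PQ_def)
  have measPQ: "measurable (PiM (insert i I) PQ) = measurable (PiM (insert i I) (\<lambda>_. N))"
    by (intro ext measurable_cong_sets sets_PiM_cong refl) (auto simp: PQ_def sets)
  have "emeasure (PiM (insert i I) P) S = (\<integral>\<^sup>+x. h x \<partial>PiM (insert i I) P)"
    unfolding h_def by (subst nn_integral_indicator) (auto simp: setsPi)
  also have "\<dots> = (\<integral>\<^sup>+y. (\<integral>\<^sup>+x. h (x(i := y)) \<partial>PiM I P) \<partial>P i)"
    by (rule P.product_nn_integral_insert_rev) (use insert.hyps h in \<open>auto simp: measPi\<close>)
  also have "\<dots> \<le> (\<integral>\<^sup>+y. (\<integral>\<^sup>+x. h (x(i := y)) \<partial>PiM I Q) \<partial>P i)"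
    by (intro nn_integral_mono 1) (simp add: spaces)
  also have "\<dots> = (\<integral>\<^sup>+x. h x \<partial>PiM (insert i I) PQ)"
    using PQ.product_nn_integral_insert_rev[OF insert.hyps, of h] h PQI
    by (simp add: measPQ PQ_def)
  also have "\<dots> = (\<integral>\<^sup>+x. (\<integral>\<^sup>+y. h (x(i := y)) \<partial>P i) \<partial>PiM I Q)"
    using PQ.product_nn_integral_insert[OF insert.hyps, of h] h PQI
    by (simp add: measPQ PQ_def)
  also have "\<dots> \<le> (\<integral>\<^sup>+x. (\<integral>\<^sup>+y. h (x(i := y)) \<partial>Q i) \<partial>PiM I Q)"
    by (intro nn_integral_mono 2) (simp add: spPi)
  also have "\<dots> = (\<integral>\<^sup>+x. h x \<partial>PiM (insert i I) Q)"
    by (rule Q.product_nn_integral_insert[symmetric]) (use insert.hyps h in \<open>auto simp: measPi\<close>)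
  also have "\<dots> = emeasure (PiM (insert i I) Q) S"
    unfolding h_def by (subst nn_integral_indicator) (auto simp: setsPi)
  finally show ?case .
qed

section \<open>Conditioning on the behaviour of the queue\<close>

text \<open>Injectivity keeps the members of a finite subfamily distinct, so intersections and
  products transfer along the inverse of \<open>f\<close>.\<close>

lemma (in prob_space) indep_sets_reindex:
  assumes f: "inj_on f I" and indep: "indep_sets F (f ` I)"
  shows "indep_sets (\<lambda>i. F (f i)) I"
  unfolding indep_sets_def
proof (intro conjI ballI allI impI)
  show "F (f i) \<subseteq> events" if "i \<in> I" for i
    using indep that by (auto simp: indep_sets_def)
  fix J A assume J: "J \<subseteq> I" "J \<noteq> {}" "finite J" and A: "A \<in> Pi J (\<lambda>i. F (f i))"
  have inj: "inj_on f J" using f J(1) by (rule inj_on_subset)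
  have inv: "the_inv_into J f (f j) = j" if "j \<in> J" for j
    using inj that by (rule the_inv_into_f_f)
  have "prob (\<Inter>x\<in>f ` J. A (the_inv_into J f x)) = (\<Prod>x\<in>f ` J. prob (A (the_inv_into J f x)))"
    by (rule indep_setsD[OF indep]) (use J A inv in auto)
  then show "prob (\<Inter>j\<in>J. A j) = (\<Prod>j\<in>J. prob (A j))"
    by (simp add: prod.reindex[OF inj] inv cong: INF_cong prod.cong)
qed

text \<open>Total probability over the countably many values of \<open>T\<close>. Intersections in
  place of conditional probabilities avoid dividing by the mass of null fibres.\<close>

lemma (in prob_space) prob_mono_on_fibres:
  fixes T :: "'a \<Rightarrow> 't :: countable"
  assumes T: "T \<in> M \<rightarrow>\<^sub>M count_space UNIV"
    and S: "S \<in> events" "S' \<in> events"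
    and le: "\<And>t. prob ({\<omega> \<in> space M. T \<omega> = t} \<inter> S) \<le> prob ({\<omega> \<in> space M. T \<omega> = t} \<inter> S')"
  shows "prob S \<le> prob S'"
proof -
  have fibre: "{\<omega> \<in> space M. T \<omega> = t} \<in> events" for t
    using measurable_sets[OF T, of "{t}"] by (simp add: vimage_def Int_def conj_commute)
  have split: "emeasure M X = (\<integral>\<^sup>+t. emeasure M ({\<omega> \<in> space M. T \<omega> = t} \<inter> X) \<partial>count_space UNIV)"
    if X: "X \<in> events" for X
  proof -
    have "(\<Union>t. {\<omega> \<in> space M. T \<omega> = t} \<inter> X) = X" using sets.sets_into_space[OF X] by auto
    moreover have "emeasure M (\<Union>t. {\<omega> \<in> space M. T \<omega> = t} \<inter> X) =
      (\<integral>\<^sup>+t. emeasure M ({\<omega> \<in> space M. T \<omega> = t} \<inter> X) \<partial>count_space UNIV)"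
      by (rule emeasure_UN_countable) (use fibre X in \<open>auto simp: disjoint_family_on_def\<close>)
    ultimately show ?thesis by simp
  qed
  have "emeasure M S \<le> emeasure M S'"
    unfolding split[OF S(1)] split[OF S(2)]
    by (intro nn_integral_mono) (simp add: emeasure_eq_measure le)
  then show ?thesis by (simp add: emeasure_eq_measure)
qed

text \<open>Countability lets an arbitrary \<open>g\<close> be handled one value at a time.\<close>

lemma measurable_count_space_map2:
  fixes X :: "'a \<Rightarrow> 'b :: countable" and Y :: "'a \<Rightarrow> 'c :: countable"
  assumes X: "X \<in> N \<rightarrow>\<^sub>M count_space UNIV" and Y: "Y \<in> N \<rightarrow>\<^sub>M count_space UNIV"
  shows "(\<lambda>\<omega>. g (X \<omega>) (Y \<omega>)) \<in> N \<rightarrow>\<^sub>M count_space UNIV"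
  by (rule measurable_compose_countable[OF measurable_compose_countable[OF _ Y] X]) simp

lemma measurable_count_space_map:
  fixes X :: "'i \<Rightarrow> 'a \<Rightarrow> 'b :: countable"
  assumes "\<And>i. i \<in> set xs \<Longrightarrow> X i \<in> N \<rightarrow>\<^sub>M count_space UNIV"
  shows "(\<lambda>\<omega>. map (\<lambda>i. X i \<omega>) xs) \<in> N \<rightarrow>\<^sub>M count_space UNIV"
  using assms
proof (induction xs)
  case (Cons i xs)
  then show ?case using measurable_count_space_map2[of "X i" N "\<lambda>\<omega>. map (\<lambda>i. X i \<omega>) xs" "(#)"] by simp
qed simp

lemma nonidling_of_service_discipline:
  "service_discipline US d \<Longrightarrow> u \<in> space US \<Longrightarrow> nonidling (d u)"
  by (auto simp: service_discipline_def nonidling_def)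

lemma prob_space_density: "is_density f \<Longrightarrow> prob_space (density lborel f)"
  by (rule prob_spaceI) (simp add: emeasure_density is_density_def)

text \<open>
  Everything the queue does up to the end of slot \<open>m\<close>; \<open>L\<close> enumerates the situations in which
  the discipline may be consulted.
\<close>

definition queue_trace where
  "queue_trace m L A C U d \<omega> =
    (map (\<lambda>k. A k \<omega>) [1..<Suc m], map (\<lambda>k. C k \<omega>) [1..<Suc m], map (\<lambda>x. d (U \<omega>) (fst x) (snd x)) L)"
  for A C :: "nat \<Rightarrow> 'w \<Rightarrow> bool" and U :: "'w \<Rightarrow> 'u" and d :: "'u discipline"

lemma queue_traceD:
  assumes "queue_trace m L A C U d \<omega> = queue_trace m L A C U d \<omega>'"
  shows "\<And>i. 1 \<le> i \<Longrightarrow> i \<le> m \<Longrightarrow> A i \<omega> = A i \<omega>'"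
    and "\<And>i. 1 \<le> i \<Longrightarrow> i \<le> m \<Longrightarrow> C i \<omega> = C i \<omega>'"
    and "\<And>h B. (h, B) \<in> set L \<Longrightarrow> d (U \<omega>) h B = d (U \<omega>') h B"
  using assms by (auto simp: queue_trace_def)

text \<open>Meant for \<open>n > q\<close>, where the assigned index exceeds \<open>q\<close> and so
  has a sampling slot; \<open>V\<close> at this slot is then the value assigned to the
  \<open>n\<close>-th reception.\<close>

definition reception_source where
  "reception_source q A C U d m \<omega> n =
    sampling_slot q (\<lambda>k. A k \<omega>) (nth_received q (\<lambda>k. A k \<omega>) (\<lambda>k. C k \<omega>) (d (U \<omega>)) m n)"
  for A C :: "nat \<Rightarrow> 'w \<Rightarrow> bool" and U :: "'w \<Rightarrow> 'u" and d :: "'u discipline"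

section \<open>Joint law of the slot measurements\<close>

context sensor_model
begin

lemma f_measurable: "f0 \<in> borel_measurable borel" "f1 \<in> borel_measurable borel"
  using densities by (auto simp: is_density_def)

lemma V_measurable: "1 \<le> k \<Longrightarrow> V k \<in> borel_measurable M"
  using distributed_measurable[OF V_dist] by simp

abbreviation "slot_density k \<equiv> (\<lambda>x. ennreal (if enat k \<le> \<nu> then f0 x else f1 x))"

lemma distr_V: "1 \<le> k \<Longrightarrow> distr M lborel (V k) = density lborel (slot_density k)"
  by (rule distributed_distr_eq_density[OF V_dist])

lemma prob_space_slot_density: "prob_space (density lborel (slot_density k))"
  using prob_space_density[OF densities(1)] prob_space_density[OF densities(2)]
  by (cases "enat k \<le> \<nu>") simp_all

text \<open>The two densities differ only if \<open>k \<le> \<nu> < l\<close>, and then the passage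
  is from \<open>f0\<close> to \<open>f1\<close>.\<close>

lemma slot_density_upset_le:
  assumes "k \<le> l" "S \<in> sets lborel"
    "upset (\<lambda>x y. log_ratio (f1 x) (f0 x) \<le> log_ratio (f1 y) (f0 y)) (space lborel) S"
  shows "emeasure (density lborel (slot_density k)) S \<le> emeasure (density lborel (slot_density l)) S"
proof (cases "enat k \<le> \<nu> \<and> \<not> enat l \<le> \<nu>")
  case True
  have "emeasure (density lborel f0) S \<le> emeasure (density lborel f1) S"
    using assms by (intro density_upset_le densities) (auto simp: upset_def)
  then show ?thesis using True by simp
next
  case False
  moreover have "enat k \<le> \<nu>" if "enat l \<le> \<nu>"
    using assms(1) by (intro order.trans[OF _ that]) simp
  ultimately show ?thesis using False by (cases "enat k \<le> \<nu>"; cases "enat l \<le> \<nu>") simp_all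
qed

abbreviation "E \<equiv> source_sets M US A C V W U"

lemma source_sets_subset: "E s \<subseteq> Pow (space M)"
  unfolding source_sets_def
  by (rule order.trans[OF sets.space_closed]) (simp split: source.split)

lemma indep_vars_V:
  assumes k: "inj_on k I" "k ` I \<subseteq> {1..}"
  shows "indep_vars (\<lambda>_. lborel) (\<lambda>i. V (k i)) I"
proof -
  have "inj_on (\<lambda>i. Slot_Meas (k i)) I" using k by (auto simp: inj_on_def)
  moreover have "indep_sets E ((\<lambda>i. Slot_Meas (k i)) ` I)"
    by (rule indep_sets_mono_index[OF _ indep]) (use k in auto)
  ultimately have "indep_sets (\<lambda>i. E (Slot_Meas (k i))) I"
    by (rule indep_sets_reindex)
  then have "indep_sets (\<lambda>i. {V (k i) -` B \<inter> space M |B. B \<in> sets lborel}) I"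
    by (rule indep_sets_mono_sets) (auto simp: source_sets_def intro: in_vimage_algebra)
  then show ?thesis
    unfolding indep_vars_def2 using k by (auto intro!: V_measurable)
qed

lemma distr_V_PiM:
  assumes k: "inj_on k I" "k ` I \<subseteq> {1..}" and I: "I \<noteq> {}"
  shows "distr M (PiM I (\<lambda>_. lborel)) (\<lambda>\<omega>. \<lambda>i\<in>I. V (k i) \<omega>) =
    PiM I (\<lambda>i. density lborel (slot_density (k i)))"
proof -
  have "distr M (PiM I (\<lambda>_. lborel)) (\<lambda>\<omega>. \<lambda>i\<in>I. V (k i) \<omega>) =
      PiM I (\<lambda>i. distr M lborel (V (k i)))"
    using indep_vars_V[OF k] k V_measurable
    by (subst (asm) indep_vars_iff_distr_eq_PiM'[OF I]) auto
  also have "\<dots> = PiM I (\<lambda>i. density lborel (slot_density (k i)))"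
    by (intro PiM_cong refl distr_V) (use k in auto)
  finally show ?thesis .
qed

lemma measurable_restrict_V:
  assumes "k ` I \<subseteq> {1..}"
  shows "(\<lambda>\<omega>. \<lambda>i\<in>I. V (k i) \<omega>) \<in> M \<rightarrow>\<^sub>M PiM I (\<lambda>_. lborel)"
  using assms by (intro measurable_restrict) (auto intro!: V_measurable)

text \<open>Only joint laws are compared, so the slots \<open>k i\<close> and \<open>l i\<close> may
  overlap in any way. Each law is a product of slot densities, and these are ordered factor by
  factor.\<close>

lemma prob_V_upset_le:
  assumes k: "inj_on k I" "k ` I \<subseteq> {1..}" and l: "inj_on l I" "l ` I \<subseteq> {1..}"
    and kl: "\<And>i. i \<in> I \<Longrightarrow> k i \<le> l i" and I: "finite I"
    and S: "S \<in> sets (PiM I (\<lambda>_. lborel))"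
      "upset (\<lambda>x y. \<forall>i\<in>I. log_ratio (f1 (x i)) (f0 (x i)) \<le> log_ratio (f1 (y i)) (f0 (y i)))
        (space (PiM I (\<lambda>_. lborel))) S"
  shows "prob {\<omega> \<in> space M. (\<lambda>i\<in>I. V (k i) \<omega>) \<in> S} \<le> prob {\<omega> \<in> space M. (\<lambda>i\<in>I. V (l i) \<omega>) \<in> S}"
proof (cases "I = {}")
  case False
  have eq: "emeasure M {\<omega> \<in> space M. (\<lambda>i\<in>I. V (k i) \<omega>) \<in> S} =
      emeasure (PiM I (\<lambda>i. density lborel (slot_density (k i)))) S"
    if "inj_on k I" "k ` I \<subseteq> {1..}" for k
    unfolding distr_V_PiM[OF that False, symmetric]
    by (subst emeasure_distr[OF measurable_restrict_V[OF that(2)] S(1)])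
      (auto intro!: arg_cong[where f="emeasure M"])
  have "emeasure (PiM I (\<lambda>i. density lborel (slot_density (k i)))) S
    \<le> emeasure (PiM I (\<lambda>i. density lborel (slot_density (l i)))) S"
    by (rule emeasure_PiM_upset_le[where N=lborel, OF _ _ _ _ _ _ I S])
      (auto intro: prob_space_slot_density slot_density_upset_le kl)
  then show ?thesis
    unfolding eq[OF k, symmetric] eq[OF l, symmetric] by (simp add: emeasure_eq_measure)
qed (simp add: restrict_def)

section \<open>Independence of queue and measurements\<close>

definition "queue_algebra = sigma (space M) (\<Union>s\<in>Arrival ` {1..} \<union> Channel ` {1..} \<union> {Seed}. E s)"

text \<open>Slot measurements suffice: the statistic reads only receptions after the
  \<open>q\<close>-th, whose assigned indices exceed \<open>q\<close>.\<close>

definition "meas_algebra = sigma (space M) (\<Union>s\<in>Slot_Meas ` {1..}. E s)"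

lemma space_algebras [simp]: "space queue_algebra = space M" "space meas_algebra = space M"
  unfolding queue_algebra_def meas_algebra_def
  by (rule space_measure_of, use source_sets_subset in blast)+

lemma sets_algebras:
  "sets queue_algebra = sigma_sets (space M) (\<Union>s\<in>Arrival ` {1..} \<union> Channel ` {1..} \<union> {Seed}. E s)"
  "sets meas_algebra = sigma_sets (space M) (\<Union>s\<in>Slot_Meas ` {1..}. E s)"
  unfolding queue_algebra_def meas_algebra_def
  by (rule sets_measure_of, use source_sets_subset in blast)+

text \<open>The sources are grouped into two disjoint blocks, and independence passes to the
  generated sigma-algebras because each \<open>E s\<close> is stable under intersection.\<close>

lemma prob_Int_algebras:
  assumes a: "a \<in> sets queue_algebra" and b: "b \<in> sets meas_algebra"
  shows "prob (a \<inter> b) = prob a * prob b"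
proof -
  define I where "I = case_bool (Arrival ` {1..} \<union> Channel ` {1..} \<union> {Seed}) (Slot_Meas ` {1..})"
  have "indep_sets (\<lambda>j. sigma_sets (space M) (\<Union>s\<in>I j. E s)) UNIV"
  proof (rule indep_sets_collect_sigma)
    show "indep_sets E (\<Union>j. I j)"
      by (rule indep_sets_mono_index[OF _ indep]) (auto simp: I_def split: bool.splits)
    show "Int_stable (E s)" for s unfolding source_sets_def by (rule sets.Int_stable)
    show "disjoint_family_on I UNIV"
      by (auto simp: disjoint_family_on_def I_def split: bool.splits)
  qed
  then have "prob (\<Inter>j\<in>UNIV. case_bool a b j) = (\<Prod>j\<in>UNIV. prob (case_bool a b j))"
    by (rule indep_setsD) (use a b in \<open>auto simp: I_def sets_algebras split: bool.splits\<close>)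
  then show ?thesis by (simp add: UNIV_bool ac_simps)
qed

lemma measurable_source:
  assumes "X -` B \<inter> space M \<in> E s" "s \<in> Sr"
  shows "X -` B \<inter> space M \<in> sigma_sets (space M) (\<Union>s\<in>Sr. E s)"
  using assms by (auto intro: sigma_sets.Basic)

lemma queue_algebra_measurable:
  shows "1 \<le> k \<Longrightarrow> A k \<in> queue_algebra \<rightarrow>\<^sub>M count_space UNIV"
    and "1 \<le> k \<Longrightarrow> C k \<in> queue_algebra \<rightarrow>\<^sub>M count_space UNIV"
    and "U \<in> queue_algebra \<rightarrow>\<^sub>M US"
proof -
  show "A k \<in> queue_algebra \<rightarrow>\<^sub>M count_space UNIV" if "1 \<le> k"
    by (rule measurableI, simp, simp only: sets_algebras space_algebras,
        rule measurable_source[where s="Arrival k"])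
      (use that in \<open>auto simp: source_sets_def intro: in_vimage_algebra\<close>)
  show "C k \<in> queue_algebra \<rightarrow>\<^sub>M count_space UNIV" if "1 \<le> k"
    by (rule measurableI, simp, simp only: sets_algebras space_algebras,
        rule measurable_source[where s="Channel k"])
      (use that in \<open>auto simp: source_sets_def intro: in_vimage_algebra\<close>)
  show "U \<in> queue_algebra \<rightarrow>\<^sub>M US"
    by (rule measurableI, use measurable_space[OF U_meas] in simp,
        simp only: sets_algebras space_algebras, rule measurable_source[where s=Seed])
      (auto simp: source_sets_def intro: in_vimage_algebra)
qed

lemma meas_algebra_measurable: "1 \<le> k \<Longrightarrow> V k \<in> borel_measurable meas_algebra"
  by (rule measurableI, simp, simp only: sets_algebras space_algebras,
        rule measurable_source[where s="Slot_Meas k"])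
      (auto simp: source_sets_def intro: in_vimage_algebra)

text \<open>Stated for any \<open>N\<close>: with \<open>M\<close> it serves the measurability of
  the statistic, with \<open>queue_algebra\<close> it makes the fibres of the trace queue
  events.\<close>

lemma queue_trace_measurable:
  assumes d: "service_discipline US d"
    and "\<And>k. 1 \<le> k \<Longrightarrow> A k \<in> N \<rightarrow>\<^sub>M count_space UNIV" "\<And>k. 1 \<le> k \<Longrightarrow> C k \<in> N \<rightarrow>\<^sub>M count_space UNIV"
    and U: "U \<in> N \<rightarrow>\<^sub>M US"
  shows "queue_trace m L A C U d \<in> N \<rightarrow>\<^sub>M count_space UNIV"
proof -
  have "(\<lambda>\<omega>. d (U \<omega>) h B) \<in> N \<rightarrow>\<^sub>M count_space UNIV" for h B
    using d by (intro measurable_compose[OF U]) (auto simp: service_discipline_def)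
  then have "(\<lambda>\<omega>. map (\<lambda>x. d (U \<omega>) (fst x) (snd x)) L) \<in> N \<rightarrow>\<^sub>M count_space UNIV"
    by (intro measurable_count_space_map)
  moreover have "(\<lambda>\<omega>. map (\<lambda>k. A k \<omega>) [1..<Suc m]) \<in> N \<rightarrow>\<^sub>M count_space UNIV"
    by (rule measurable_count_space_map, rule assms(2)) auto
  moreover have "(\<lambda>\<omega>. map (\<lambda>k. C k \<omega>) [1..<Suc m]) \<in> N \<rightarrow>\<^sub>M count_space UNIV"
    by (rule measurable_count_space_map, rule assms(3)) auto
  ultimately show ?thesis
    unfolding queue_trace_def[abs_def]
    by (intro measurable_count_space_map2[where g=Pair])
qed

text \<open>The queue runs along \<open>\<omega>0\<close> while the measurements are read at
  \<open>\<omega>\<close>. As a function of \<open>\<omega>\<close> this is measurable for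
  \<open>meas_algebra\<close>, hence independent of the queue.\<close>

definition cusum_given where
  "cusum_given d m \<omega>0 \<omega> =
    cusum_of p0 p1 f0 f1 q (\<lambda>k. A k \<omega>0) (\<lambda>k. C k \<omega>0) (d (U \<omega>0)) m
      (\<lambda>n. V (reception_source q A C U d m \<omega>0 n) \<omega>)"

lemma nonidling_at: "service_discipline US d \<Longrightarrow> \<omega> \<in> space M \<Longrightarrow> nonidling (d (U \<omega>))"
  by (rule nonidling_of_service_discipline[OF _ measurable_space[OF U_meas]])

context
  fixes d :: "'u discipline" and m :: nat
  assumes d: "service_discipline US d" and m: "1 \<le> m"
begin

lemma reception_source_mem:
  assumes "\<omega> \<in> space M" "n \<in> {q<..departures q (\<lambda>k. A k \<omega>) (\<lambda>k. C k \<omega>) (d (U \<omega>)) m}"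
  shows "reception_source q A C U d m \<omega> n \<in> {1..m}"
proof -
  have "nth_received q (\<lambda>k. A k \<omega>) (\<lambda>k. C k \<omega>) (d (U \<omega>)) m n \<in> {n..sampled q (\<lambda>k. A k \<omega>) m}"
    using assms by (intro nth_received_mem nonidling_at d) auto
  then show ?thesis
    unfolding reception_source_def using assms by (intro sampling_slot(2)) auto
qed

text \<open>\<open>sampled\<close> recovers the index from its sampling slot, and distinct
  receptions have distinct indices. Independence of the assigned values rests on the slots being
  distinct.\<close>

lemma inj_on_reception_source:
  assumes \<omega>: "\<omega> \<in> space M"
  shows "inj_on (reception_source q A C U d m \<omega>)
    {q<..departures q (\<lambda>k. A k \<omega>) (\<lambda>k. C k \<omega>) (d (U \<omega>)) m}" (is "inj_on _ ?I")
proof (rule inj_onI)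
  fix n n' assume n: "n \<in> ?I" "n' \<in> ?I"
    and eq: "reception_source q A C U d m \<omega> n = reception_source q A C U d m \<omega> n'"
  let ?N = "nth_received q (\<lambda>k. A k \<omega>) (\<lambda>k. C k \<omega>) (d (U \<omega>)) m"
  have "sampled q (\<lambda>k. A k \<omega>) (reception_source q A C U d m \<omega> i) = ?N i" if "i \<in> ?I" for i
    unfolding reception_source_def
    using that nth_received_mem[OF nonidling_at[OF d \<omega>], of i q "\<lambda>k. A k \<omega>" "\<lambda>k. C k \<omega>" m]
    by (intro sampling_slot(1)[where k=m]) auto
  then have "?N n = ?N n'" using n eq by metis
  then show "n = n'"
    by (rule inj_onD[OF inj_on_nth_received[OF nonidling_at[OF d \<omega>]]]) (use n in auto)
qed

text \<open>Equal traces mean equal arrivals, channel states and choices of the discipline up to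
  slot \<open>m\<close>. So the path at \<open>\<omega>\<close> may be replaced by that at
  \<open>\<omega>0\<close>, and only the measurements are still read at
  \<open>\<omega>\<close>.\<close>

lemma cusum_rv_eq_cusum_given:
  assumes L: "set L = states q m" and \<omega>: "\<omega> \<in> space M" "\<omega>0 \<in> space M"
    and eq: "queue_trace m L A C U d \<omega> = queue_trace m L A C U d \<omega>0"
  shows "cusum_rv p0 p1 f0 f1 q A C V W U d m \<omega> = cusum_given d m \<omega>0 \<omega>"
proof -
  let ?A = "\<lambda>\<omega> k. A k \<omega>" and ?C = "\<lambda>\<omega> k. C k \<omega>"
  note eqs = queue_traceD[OF eq, unfolded L]
  note nd = nonidling_at[OF d \<omega>(1)] nonidling_at[OF d \<omega>(2)]
  have nth: "nth_received q (?A \<omega>) (?C \<omega>) (d (U \<omega>)) m n =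
      nth_received q (?A \<omega>0) (?C \<omega>0) (d (U \<omega>0)) m n" for n
    unfolding nth_received_def using received_cong[OF nd(1) eqs] by simp
  have z: "meas q A V W (nth_received q (?A \<omega>) (?C \<omega>) (d (U \<omega>)) m n) \<omega> =
      V (reception_source q A C U d m \<omega>0 n) \<omega>"
    if n: "n \<in> {q<..departures q (?A \<omega>0) (?C \<omega>0) (d (U \<omega>0)) m}" for n
  proof -
    let ?n = "nth_received q (?A \<omega>0) (?C \<omega>0) (d (U \<omega>0)) m n"
    have mem: "?n \<in> {n..sampled q (?A \<omega>0) m}"
      using n by (intro nth_received_mem nd) auto
    have "sampling_slot q (?A \<omega>0) ?n = sampling_slot q (?A \<omega>) ?n"
      by (rule sampling_slot_cong[where k=m]) (use eqs(1) mem n in auto)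
    \<comment> \<open>The index is at least \<open>n > q\<close>, so \<open>meas\<close> takes its
      \<open>V\<close> branch.\<close>
    then show ?thesis using mem n by (simp add: nth meas_def reception_source_def)
  qed
  have "cusum_rv p0 p1 f0 f1 q A C V W U d m \<omega> =
    cusum_of p0 p1 f0 f1 q (?A \<omega>) (?C \<omega>) (d (U \<omega>)) m
      (\<lambda>n. meas q A V W (nth_received q (?A \<omega>) (?C \<omega>) (d (U \<omega>)) m n) \<omega>)"
    unfolding cusum_rv_def by (rule cusum_eq_cusum_of)
  also have "\<dots> = cusum_of p0 p1 f0 f1 q (?A \<omega>0) (?C \<omega>0) (d (U \<omega>0)) m
      (\<lambda>n. meas q A V W (nth_received q (?A \<omega>) (?C \<omega>) (d (U \<omega>)) m n) \<omega>)"
    by (rule cusum_of_path_cong[OF nd(1) eqs])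
  also have "\<dots> = cusum_given d m \<omega>0 \<omega>"
    unfolding cusum_given_def by (rule cusum_of_cong[OF m z])
  finally show ?thesis .
qed

lemma cusum_given_measurable:
  assumes \<omega>0: "\<omega>0 \<in> space M" and V: "\<And>k. 1 \<le> k \<Longrightarrow> V k \<in> borel_measurable N"
  shows "cusum_given d m \<omega>0 \<in> borel_measurable N"
  unfolding cusum_given_def[abs_def]
  by (rule borel_measurable_cusum_of[OF f_measurable m])
    (use reception_source_mem[OF \<omega>0] V in auto)

text \<open>The trace has countably many values, and on each of its fibres the statistic is
  \<open>cusum_given\<close> at a representative point of the fibre, chosen as
  \<open>rep\<close>.\<close>

lemma cusum_rv_measurable: "cusum_rv p0 p1 f0 f1 q A C V W U d m \<in> borel_measurable M"
proof -
  obtain L where L: "set L = states q m" using finite_list[OF finite_states] by blast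
  let ?T = "queue_trace m L A C U d"
  define rep where "rep t = (SOME \<omega>. \<omega> \<in> space M \<and> ?T \<omega> = t)" for t
  define F where "F t = (if t \<in> ?T ` space M then cusum_given d m (rep t) else (\<lambda>_. 0))" for t
  have rep: "rep t \<in> space M \<and> ?T (rep t) = t" if "t \<in> ?T ` space M" for t
    unfolding rep_def by (rule someI_ex) (use that in auto)
  have "F t \<in> borel_measurable M" for t
    using rep[of t] by (auto simp: F_def intro!: cusum_given_measurable V_measurable)
  then have "(\<lambda>\<omega>. F (?T \<omega>) \<omega>) \<in> borel_measurable M"
    by (rule measurable_compose_countable) (intro queue_trace_measurable[OF d] A_meas C_meas U_meas)
  moreover have "F (?T \<omega>) \<omega> = cusum_rv p0 p1 f0 f1 q A C V W U d m \<omega>" if "\<omega> \<in> space M" for \<omega>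
    using that rep[of "?T \<omega>"] cusum_rv_eq_cusum_given[OF L that, of "rep (?T \<omega>)"]
    by (simp add: F_def)
  ultimately show ?thesis by (simp cong: measurable_cong)
qed

end

section \<open>Comparison of two disciplines\<close>

lemma prob_cusum_given_le:
  assumes d: "service_discipline US d" "service_discipline US d'" and m: "1 \<le> m"
    and \<omega>0: "\<omega>0 \<in> space M"
    and le: "\<And>n. n \<in> {1..departures q (\<lambda>k. A k \<omega>0) (\<lambda>k. C k \<omega>0) (d (U \<omega>0)) m} \<Longrightarrow>
      nth_received q (\<lambda>k. A k \<omega>0) (\<lambda>k. C k \<omega>0) (d (U \<omega>0)) m n
        \<le> nth_received q (\<lambda>k. A k \<omega>0) (\<lambda>k. C k \<omega>0) (d' (U \<omega>0)) m n"
  shows "prob {\<omega> \<in> space M. x < cusum_given d m \<omega>0 \<omega>} \<le> prob {\<omega> \<in> space M. x < cusum_given d' m \<omega>0 \<omega>}"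
proof -
  let ?A = "\<lambda>k. A k \<omega>0" and ?C = "\<lambda>k. C k \<omega>0"
  let ?D = "departures q ?A ?C (d (U \<omega>0)) m"
  define I where "I = {q<..?D}"
  let ?P = "PiM I (\<lambda>_. lborel :: real measure)"
  \<comment> \<open>By \<open>cusum_of_discipline\<close> this one function serves both disciplines;
    they differ only in the slots whose measurements are inserted.\<close>
  define G where "G = cusum_of p0 p1 f0 f1 q ?A ?C (d (U \<omega>0)) m"
  define S where "S = {z \<in> space ?P. x < G z}"
  note nd = nonidling_at[OF d(1) \<omega>0] nonidling_at[OF d(2) \<omega>0]
  have D: "departures q ?A ?C (d' (U \<omega>0)) m = ?D" by (rule departures_eq[OF nd(2,1)])
  have "G \<in> borel_measurable ?P"
    unfolding G_def by (rule borel_measurable_cusum_of[OF f_measurable m]) (auto simp: I_def)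
  then have S: "S \<in> sets ?P" unfolding S_def by measurable
  \<comment> \<open>\<open>G\<close> is monotone in the log-likelihood ratios, so its superlevel set
    is upward closed.\<close>
  have up: "upset (\<lambda>x y. \<forall>i\<in>I. log_ratio (f1 (x i)) (f0 (x i)) \<le> log_ratio (f1 (y i)) (f0 (y i))) (space ?P) S"
    unfolding upset_def
  proof (intro conjI ballI impI)
    fix y z assume y: "y \<in> S" and z: "z \<in> space ?P"
      and yz: "\<forall>i\<in>I. log_ratio (f1 (y i)) (f0 (y i)) \<le> log_ratio (f1 (z i)) (f0 (z i))"
    have "G y \<le> G z" unfolding G_def by (rule cusum_of_mono[OF m]) (use yz in \<open>simp add: I_def\<close>)
    then show "z \<in> S" using y z by (auto simp: S_def)
  qed (auto simp: S_def)
  have G: "cusum_given d m \<omega>0 \<omega> = G (\<lambda>n\<in>I. V (reception_source q A C U d m \<omega>0 n) \<omega>)"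
    "cusum_given d' m \<omega>0 \<omega> = G (\<lambda>n\<in>I. V (reception_source q A C U d' m \<omega>0 n) \<omega>)" for \<omega>
    unfolding cusum_given_def G_def cusum_of_discipline[OF nd(2,1)]
    by (rule cusum_of_cong[OF m], simp add: I_def)+
  \<comment> \<open>For \<open>n\<close> in \<open>I\<close> both indices exceed \<open>q\<close>,
    and the smaller index was sampled no later.\<close>
  have "reception_source q A C U d m \<omega>0 n \<le> reception_source q A C U d' m \<omega>0 n" if "n \<in> I" for n
    unfolding reception_source_def
    using that le[of n] D nth_received_mem[OF nd(1), of n q ?A ?C m] nth_received_mem[OF nd(2), of n q ?A ?C m]
    by (intro sampling_slot_mono[where k=m]) (auto simp: I_def)
  moreover have "reception_source q A C U d m \<omega>0 ` I \<subseteq> {1..}"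
      "reception_source q A C U d' m \<omega>0 ` I \<subseteq> {1..}"
    using reception_source_mem[OF d(1) m \<omega>0] reception_source_mem[OF d(2) m \<omega>0]
    unfolding I_def D atLeastAtMost_iff by blast+
  moreover have "inj_on (reception_source q A C U d m \<omega>0) I" "inj_on (reception_source q A C U d' m \<omega>0) I"
    using inj_on_reception_source[OF d(1) m \<omega>0] inj_on_reception_source[OF d(2) m \<omega>0]
    unfolding I_def D by blast+
  moreover have "finite I" by (simp add: I_def)
  ultimately have "prob {\<omega> \<in> space M. (\<lambda>n\<in>I. V (reception_source q A C U d m \<omega>0 n) \<omega>) \<in> S}
    \<le> prob {\<omega> \<in> space M. (\<lambda>n\<in>I. V (reception_source q A C U d' m \<omega>0 n) \<omega>) \<in> S}"
    using S up by (intro prob_V_upset_le)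
  moreover have "(\<lambda>n\<in>I. v n) \<in> S \<longleftrightarrow> x < G (\<lambda>n\<in>I. v n)" for v :: "nat \<Rightarrow> real"
    by (simp add: S_def space_PiM)
  ultimately show ?thesis by (simp only: G)
qed

lemma st_le_cusum_rv:
  assumes d: "service_discipline US d" "service_discipline US d'" and m: "1 \<le> m"
    and le: "\<And>a c u n. u \<in> space US \<Longrightarrow> n \<in> {1..departures q a c (d u) m} \<Longrightarrow>
      nth_received q a c (d u) m n \<le> nth_received q a c (d' u) m n"
  shows "st_le M (cusum_rv p0 p1 f0 f1 q A C V W U d m) (cusum_rv p0 p1 f0 f1 q A C V W U d' m)"
  unfolding st_le_def
proof (intro conjI allI cusum_rv_measurable d m)
  fix x :: real
  let ?X = "cusum_rv p0 p1 f0 f1 q A C V W U d m" and ?X' = "cusum_rv p0 p1 f0 f1 q A C V W U d' m"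
  obtain L where L: "set L = states q m" using finite_list[OF finite_states] by blast
  \<comment> \<open>Both traces are recorded, so that on one fibre both disciplines can be frozen at
    the same \<open>\<omega>0\<close>.\<close>
  define T where "T \<omega> = (queue_trace m L A C U d \<omega>, queue_trace m L A C U d' \<omega>)" for \<omega>
  have T: "T \<in> N \<rightarrow>\<^sub>M count_space UNIV"
    if "\<And>k. 1 \<le> k \<Longrightarrow> A k \<in> N \<rightarrow>\<^sub>M count_space UNIV" "\<And>k. 1 \<le> k \<Longrightarrow> C k \<in> N \<rightarrow>\<^sub>M count_space UNIV"
      "U \<in> N \<rightarrow>\<^sub>M US" for N
    unfolding T_def[abs_def]
    by (rule measurable_count_space_map2[where g=Pair];
        rule queue_trace_measurable[OF d(1) that] queue_trace_measurable[OF d(2) that])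
  show "prob {\<omega> \<in> space M. ereal x < ?X \<omega>} \<le> prob {\<omega> \<in> space M. ereal x < ?X' \<omega>}"
  proof (rule prob_mono_on_fibres[of T])
    show "T \<in> M \<rightarrow>\<^sub>M count_space UNIV" by (intro T A_meas C_meas U_meas)
    show "{\<omega> \<in> space M. ereal x < ?X \<omega>} \<in> events" "{\<omega> \<in> space M. ereal x < ?X' \<omega>} \<in> events"
      using cusum_rv_measurable[OF d(1) m] cusum_rv_measurable[OF d(2) m] by measurable
    fix t
    let ?F = "{\<omega> \<in> space M. T \<omega> = t}"
    show "prob (?F \<inter> {\<omega> \<in> space M. ereal x < ?X \<omega>}) \<le> prob (?F \<inter> {\<omega> \<in> space M. ereal x < ?X' \<omega>})"
    proof (cases "?F = {}")
      case False
      then obtain \<omega>0 where \<omega>0: "\<omega>0 \<in> space M" "T \<omega>0 = t" by blast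
      have F: "?F \<in> sets queue_algebra"
        using measurable_sets[OF T[OF queue_algebra_measurable], of "{t}"]
        by (simp add: vimage_def Int_def conj_commute)
      \<comment> \<open>On the fibre the statistic equals \<open>cusum_given\<close>, an object of
        the measurement side, whereas the fibre is a queue event; hence the factorisation.\<close>
      have fibre: "prob (?F \<inter> {\<omega> \<in> space M. ereal x < cusum_rv p0 p1 f0 f1 q A C V W U e m \<omega>}) =
          prob ?F * prob {\<omega> \<in> space M. ereal x < cusum_given e m \<omega>0 \<omega>}"
        if e: "service_discipline US e" and tr: "\<And>\<omega>. T \<omega> = t \<Longrightarrow> queue_trace m L A C U e \<omega> = queue_trace m L A C U e \<omega>0"
        for e
      proof -
        have "?F \<inter> {\<omega> \<in> space M. ereal x < cusum_rv p0 p1 f0 f1 q A C V W U e m \<omega>} =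
          ?F \<inter> {\<omega> \<in> space M. ereal x < cusum_given e m \<omega>0 \<omega>}"
          using cusum_rv_eq_cusum_given[OF e m L _ \<omega>0(1) tr] by auto
        moreover have "cusum_given e m \<omega>0 \<in> borel_measurable meas_algebra"
          by (intro cusum_given_measurable[OF e m \<omega>0(1)] meas_algebra_measurable)
        then have "{\<omega> \<in> space meas_algebra. ereal x < cusum_given e m \<omega>0 \<omega>} \<in> sets meas_algebra"
          by measurable
        ultimately show ?thesis using prob_Int_algebras[OF F] by simp
      qed
      have "prob {\<omega> \<in> space M. ereal x < cusum_given d m \<omega>0 \<omega>}
        \<le> prob {\<omega> \<in> space M. ereal x < cusum_given d' m \<omega>0 \<omega>}"
        using measurable_space[OF U_meas \<omega>0(1)] le by (intro prob_cusum_given_le[OF d m \<omega>0(1)])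
      moreover have "queue_trace m L A C U d \<omega> = queue_trace m L A C U d \<omega>0" "queue_trace m L A C U d' \<omega> = queue_trace m L A C U d' \<omega>0"
        if "T \<omega> = t" for \<omega>
        using that \<omega>0(2) by (auto simp: T_def)
      ultimately show ?thesis
        by (simp add: fibre d mult_left_mono)
    qed (simp only: Int_empty_left measure_empty order.refl)
  qed
qed

end

section \<open>The two extreme disciplines\<close>

lemma service_discipline_fcfs: "service_discipline US fcfs"
  by (auto simp: service_discipline_def fcfs_def)

lemma service_discipline_lcfs: "service_discipline US lcfs"
  by (auto simp: service_discipline_def lcfs_def)

theorem proposition1:
  fixes M :: "'w measure" and US :: "'u measure"
    and r p0 p1 :: real and f0 f1 :: "real \<Rightarrow> real" and \<nu> :: enat and q m :: nat
    and A C :: "nat \<Rightarrow> 'w \<Rightarrow> bool" and V W :: "nat \<Rightarrow> 'w \<Rightarrow> real" and U :: "'w \<Rightarrow> 'u"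
    and d :: "'u discipline"
  assumes "sensor_model M US r p0 p1 f0 f1 \<nu> q A C V W U"
    and "lr_le f0 f1"
    and "service_discipline US d"
    and "m \<ge> 1"
  shows "st_le M (cusum_rv p0 p1 f0 f1 q A C V W U fcfs m)
                 (cusum_rv p0 p1 f0 f1 q A C V W U d m)
       \<and> st_le M (cusum_rv p0 p1 f0 f1 q A C V W U d m)
                 (cusum_rv p0 p1 f0 f1 q A C V W U lcfs m)"
proof -
  interpret sensor_model M US r p0 p1 f0 f1 \<nu> q A C V W U by (rule assms(1))
  note nd = nonidling_of_service_discipline[OF assms(3)]
  have "nth_received q a c (fcfs u) m n \<le> nth_received q a c (d u) m n"
    if "u \<in> space US" "n \<in> {1..departures q a c (fcfs u) m}" for a c u n
    using that fcfs_card_queue_le[OF nd] by (intro nth_received_mono nonidling_fcfs nd) auto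
  moreover have "nth_received q a c (d u) m n \<le> nth_received q a c (lcfs u) m n"
    if "u \<in> space US" "n \<in> {1..departures q a c (d u) m}" for a c u n
    using that lcfs_card_queue_ge[OF nd] by (intro nth_received_mono nonidling_lcfs nd) auto
  ultimately show ?thesis
    by (intro conjI st_le_cusum_rv service_discipline_fcfs service_discipline_lcfs assms(3,4))
qed

end
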